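(* Consider the hybrid setting of the context, in either the exact setting (E) (with $G_{\mathrm{pt}}=\mathring G$) or the practical setting (P). Consider an SSP Runge–Kutta method whose stages are convex combinations of forward Euler steps of the hybrid update with admissible substep sizes, as described in the context, and let the initial hybrid state satisfy $\bar u_K^n\in G$ for all $K$ and $u_\sigma^n\in G_{\mathrm{pt}}$ for all $\sigma$. Then every stage preserves the corresponding hybrid admissible set: every stage $u_h^{(i)}$ satisfies $\bar u_K^{(i)}\in G$ for all $K\in\mathcal T_h$ and $u_\sigma^{(i)}\in G_{\mathrm{pt}}$ for all $\sigma\in\Sigma_h$. In particular, the classical three-stage third-order SSP Runge–Kutta method $$U^{(1)}=U^n+\Delta tL(U^n),\quad U^{(2)}=\tfrac34U^n+\tfrac14\bigl(U^{(1)}+\Delta tL(U^{(1)})\bigr),\quad U^{n+1}=\tfrac13U^n+\tfrac23\bigl(U^{(2)}+\Delta tL(U^{(2)})\bigr)$$ satisfies the same conclusion under the forward Euler conservative CFL condition (for $\Delta t$, at each stage state).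
   Context: PDE: $\partial_tu+\sum_{i=1}^2\partial_{x_i}f_i(u)=0$, hyperbolic, $u\in\mathbb R^m$; $A_i=Df_i$; $F(u)\cdot n:=\sum_in_if_i(u)$. Mesh and data: $\Omega\subseteq\mathbb R^2$ is partitioned by a conforming, uniformly shape-regular mesh $\mathcal T_h$ of open convex polygonal cells $K$ with uniformly bounded number of edges; $|K|$ area, $\mathcal E_K$ edges, $|e|$ length, $n_{K,e}$ outward unit normal, $K_e$ neighbour across $e$. $\Sigma_h$ is a finite set of nodes $\sigma$ (coordinates $x_\sigma$; vertices and edge midpoints), $\Sigma_K=\{\sigma:x_\sigma\in\partial K\}$. A hybrid state is $u_h=((\bar u_K)_K,(u_\sigma)_\sigma)$ with values in $\mathbb R^m$. $\mathbb W_K\supseteq(\mathbb P^k(K))^m$ is a finite-dimensional space of smooth functions; the reconstruction $u_K=\mathcal R_K(u_h)\in\mathbb W_K$ satisfies $\frac1{|K|}\int_Ku_K=\bar u_K$, $u_K(x_\sigma)=u_\sigma$ ($\sigma\in\Sigma_K$). Edge quadrature: nodes $x_{e,\nu}\in e\cap\{x_\sigma\}$, weights $\omega_{e,\nu}>0$, $\sum_{\nu=1}^{N_q}\omega_{e,\nu}=1$, exact for edge averages of functions in $\mathbb W_K$. Invariant domain: $\mathcal J$ finite; $\mathring G=\{u:g_j(u)>0\ \forall j\in\mathcal J\}$, $G=\overline{\mathring G}=\{u:g_j(u)\ge0\ \forall j\}$ convex, $g_j$ concave, $C^1$ on an open set containing $G$; $S_j=\partial G\cap\partial\{g_j\ge0\}$,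 $n_j^*=\nabla g_j(u_j^* )\ne0$ for $u_j^*\in S_j$; $G=\{u:(u-u_j^* )\cdot n_j^*\ge0\ \forall u_j^*\in S_j,\forall j\}$. Cell average decomposition (CAD): with $\mathbb V_K\in\{(\mathbb P^k(K))^m,\mathbb W_K\}$ there are $\lambda_{K,e},\beta_{K,s}>0$ with total sum $1$ and $x_{K,s}^*\in\overline K$ with $\frac1{|K|}\int_K\phi=\sum_e\lambda_{K,e}\frac1{|e|}\int_e\phi\,ds+\sum_s\beta_{K,s}\phi(x_{K,s}^* )$ for all $\phi\in\mathbb V_K$; $\mu_K=\min_e\lambda_{K,e}|K|/|e|$. A function $\hat u_K\in\mathbb W_K$ is $G$-admissible if $\hat u_K(x_{e,\nu})\in G$ for all $e,\nu$ and, when $\sum_e\lambda_{K,e}<1$, $(\bar u_K-\sum_e\lambda_{K,e}\sum_\nu\omega_{e,\nu}\hat u_K(x_{e,\nu}))/(1-\sum_e\lambda_{K,e})\in G$. Limiter: $\Pi_K(u_K;\bar u_K)=\bar u_K+\theta_K(u_K-\bar u_K)$, where either (classic limiter, CAD on $\mathbb V_K=\mathbb W_K$) $\theta_K$ is the supremum of $\theta\in[0,1]$ with $\bar u_K+\theta(u_K(x)-\bar u_K)\in G$ for all $x\in\{x_{e,\nu}\}\cup\{x^*_{K,s}\}$, or (alternative limiter, CAD on $\mathbb V_K=(\mathbb P^k(K))^m$) $\theta_K$ is the supremum of $\theta\in[0,1]$ with $\bar u_K+\theta(u_K(x_{e,\nu})-\bar u_K)\in G$ for all $e,\nu$ and,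 if $\sum_e\lambda_{K,e}<1$, also $\bar u_K+\theta(u_K^*-\bar u_K)\in G$, with $u_K^*=(\bar u_K-\sum_e\lambda_{K,e}\frac1{|e|}\int_eu_K\,ds)/(1-\sum_e\lambda_{K,e})$. Weak Lax–Friedrichs splitting: for every $u\in G$, unit $n$ there is $\tilde\alpha(u,n)\ge0$, and for every $j$, $u_j^*\in S_j$ a vector $\zeta(u_j^* )\in\mathbb R^2$ with $\alpha(u-u_j^* )\cdot n_j^*\pm(F(u)\cdot n)\cdot n_j^*\ge\mp\zeta(u_j^* )\cdot n$ for all unit $n$ and $\alpha\ge\tilde\alpha(u,n)$. Conservative operator: given $u_h$ with $G$-admissible $\hat u_K=\Pi_K(\mathcal R_Ku_h;\bar u_K)$, let $L_K(u_h)=-\frac1{|K|}\sum_e|e|\sum_\nu\omega_{e,\nu}\bigl(\frac12[F(\hat u_{K,e,\nu})+F(\hat u_{K_e,e,\nu})]\cdot n_{K,e}-\frac{\alpha_{K,e,\nu}}2(\hat u_{K_e,e,\nu}-\hat u_{K,e,\nu})\bigr)$, where $\hat u_{K,e,\nu}=\hat u_K(x_{e,\nu})$, $\hat u_{K_e,e,\nu}=\hat u_{K_e}(x_{e,\nu})$ (a prescribed state in $G$ on boundary edges) and $\alpha_{K,e,\nu}\ge\max\{\tilde\alpha(\hat u_{K,e,\nu},n_{K,e}),\tilde\alpha(\hat u_{K_e,e,\nu},n_{K,e})\}$. The conservative CFL condition for a step $\tau$ at the state $u_h$ is $\tau\le\min_K\mu_K/(2\alpha_K)$ with $\alpha_K:=\max_{e\in\mathcal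 E_K}\max_\nu\tilde\alpha(\hat u_{K,e,\nu},n_{K,e})$. Point transform and operator: setting (E): $\Psi:\mathring G\to\mathbb R^m$ is a $C^1$ bijection with invertible $D\Psi$, $\Psi,\Psi^{-1}$ locally Lipschitz, and smooth solutions $u\in\mathring G$ satisfy $\partial_tw+\sum_iJ_i\partial_{x_i}w=0$ with $w=\Psi(u)$, $J_i=D\Psi A_i(D\Psi)^{-1}$; put $\mathcal T=\Psi$, $\mathcal B=\Psi^{-1}$, $U_{\mathrm{fwd}}=G_{\mathrm{pt}}=\mathring G$. Setting (P): $\mathcal T:U_{\mathrm{fwd}}\to\mathbb R^m$ is a given forward map and $\mathcal B:\mathbb R^m\to G_{\mathrm{pt}}$ a globally defined admissibility-preserving map with convex range $G_{\mathrm{pt}}\subseteq U_{\mathrm{fwd}}$; all transformed stage values are assumed finite (well-defined in $\mathbb R^m$). In both settings, $J_q=D\mathcal T(\sum_iq_iA_i)(D\mathcal T)^{-1}$ and $\partial_qw_{K,\sigma}=D\mathcal T(u_\sigma)(q\cdot\nabla u_K(x_\sigma))$. For $\sigma\in\Sigma_h$ let $\mathcal E_\sigma$ be the edges containing $x_\sigma$; for $e\in\mathcal E_\sigma$, $\tau_{\sigma,e}$ is the unit tangent away from $x_\sigma$, $(n_{\sigma,e},\tau_{\sigma,e})$ a right-handed orthonormal basis, $n_{\sigma,e}$ pointing from cell $K^-_{\sigma,e}$ to $K^+_{\sigma,e}$; for a vertex, $K^{\mathrm{ext}}_{\sigma,e}$ is the cell containing $x_\sigma-\varepsilon\tau_{\sigma,e}$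 for small $\varepsilon>0$ (ties broken deterministically). Weights $\omega_{\sigma,e}=\theta_{\sigma,e}/\sum_{e'}\theta_{\sigma,e'}$, $\theta_{\sigma,e}$ being half the sum of the interior angles at $\sigma$ of the cells adjacent to $e$. $\alpha_\sigma>0$ bounds the spectral radii of $J_{n_{\sigma,e}}(u_\sigma),J_{\tau_{\sigma,e}}(u_\sigma)$, and $J_q^\pm=\frac12(J_q(u_\sigma)\pm\alpha_\sigma I)$. For a vertex, $(\mathcal D^{\mathrm{pt}}(u_h))_\sigma=-\sum_{e\in\mathcal E_\sigma}\omega_{\sigma,e}(J^+_{n_{\sigma,e}}\partial_{n_{\sigma,e}}w_{K^-_{\sigma,e},\sigma}+J^-_{n_{\sigma,e}}\partial_{n_{\sigma,e}}w_{K^+_{\sigma,e},\sigma}+J^-_{\tau_{\sigma,e}}\partial_{\tau_{\sigma,e}}w_{K^-_{\sigma,e},\sigma}+J^+_{\tau_{\sigma,e}}\partial_{\tau_{\sigma,e}}w_{K^{\mathrm{ext}}_{\sigma,e},\sigma})$; for the midpoint of $e$, $(\mathcal D^{\mathrm{pt}}(u_h))_\sigma=-(J^+_{n_{\sigma,e}}\partial_{n_{\sigma,e}}w_{K^-_{\sigma,e},\sigma}+J^-_{n_{\sigma,e}}\partial_{n_{\sigma,e}}w_{K^+_{\sigma,e},\sigma}+J_{\tau_{\sigma,e}}\partial_{\tau_{\sigma,e}}w_{K^-_{\sigma,e},\sigma})$. Missing exterior data at the boundary are supplied by the boundary conditions, consistently with the physical boundary data and in a locally Lipschitz manner. SSP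 stages: $u_h^{(0)}=u_h^n$ and, for $i\ge1$, with $a_{ij}\ge0$, $\sum_{j<i}a_{ij}=1$, $c_{ij}\ge0$, $\bar u_K^{(i)}=\sum_{j<i}a_{ij}\bigl(\bar u_K^{(j)}+c_{ij}\Delta t\,L_K(u_h^{(j)})\bigr)$, $w_\sigma^{(i)}=\sum_{j<i}a_{ij}\bigl(w_\sigma^{(j)}+c_{ij}\Delta t(\mathcal D^{\mathrm{pt}}(u_h^{(j)}))_\sigma\bigr)$, $u_\sigma^{(i)}=\mathcal B(w_\sigma^{(i)})$, where on the right-hand side $w_\sigma^{(j)}=\mathcal T(u_\sigma^{(j)})$. The substep sizes are admissible if $c_{ij}\Delta t$ satisfies the conservative CFL condition at $u_h^{(j)}$ whenever $a_{ij}>0$. At every stage state $u_h^{(j)}$ the limited reconstructions used are $G$-admissible. The classical third-order method is the case with $U$ standing for cell averages $\bar u$ (with $L=(L_K)$) and for transformed point values $w$ (with $L=\mathcal D^{\mathrm{pt}}$).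
   Formalization: Two hypotheses are added, without which the claim fails: each substep τ also satisfies τ·α_{K,e,ν} ≤ (3/2)μ_K at all edge quadrature nodes; and if Σ_e λ_{K,e} = 1, the cell average decomposition is exact on W_K (this matters only for the alternative limiter with k ≤ 1). *)

theory Defs
  imports "HOL-Analysis.Analysis"
begin

section \<open>Analytic preliminaries\<close>

type_synonym pt = "real^2"

definition jacobian :: "(real^'m \<Rightarrow> real^'m) \<Rightarrow> real^'m \<Rightarrow> real^'m^'m" where
  "jacobian h u = matrix (frechet_derivative h (at u))"

definition grad :: "(real^'m \<Rightarrow> real) \<Rightarrow> real^'m \<Rightarrow> real^'m" where
  "grad h u = (THE D. GDERIV h u :> D)"

fun Ck_on :: "nat \<Rightarrow> 'a::real_normed_vector set \<Rightarrow> ('a \<Rightarrow> 'b::real_normed_vector) \<Rightarrow> bool" where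
  "Ck_on 0 D f \<longleftrightarrow> continuous_on D f"
| "Ck_on (Suc n) D f \<longleftrightarrow> (\<forall>x\<in>D. f differentiable (at x)) \<and>
     (\<forall>v. Ck_on n D (\<lambda>x. frechet_derivative f (at x) v))"

definition smooth_on :: "'a::real_normed_vector set \<Rightarrow> ('a \<Rightarrow> 'b::real_normed_vector) \<Rightarrow> bool" where
  "smooth_on D f \<longleftrightarrow> open D \<and> (\<forall>n. Ck_on n D f)"

definition locally_lipschitz_on :: "'a::metric_space set \<Rightarrow> ('a \<Rightarrow> 'b::metric_space) \<Rightarrow> bool" where
  "locally_lipschitz_on D f \<longleftrightarrow> (\<forall>x\<in>D. \<exists>r>0. \<exists>L. L-lipschitz_on (cball x r \<inter> D) f)"

definition real_diagonalizable :: "real^'m^'m \<Rightarrow> bool" where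
  "real_diagonalizable A \<longleftrightarrow> (\<exists>(P :: real^'m^'m) (D :: real^'m^'m). invertible P \<and> (\<forall>i j. i \<noteq> j \<longrightarrow> D $ i $ j = 0) \<and>
     A = P ** D ** matrix_inv P)"

text \<open>The eigenvalues are taken over the complex numbers.\<close>

definition spectral_radius :: "real^'m^'m \<Rightarrow> real" where
  "spectral_radius A = Sup {cmod l | l. \<exists>v. v \<noteq> 0 \<and>
     (\<chi> i j. complex_of_real (A $ i $ j)) *v v = l *s v}"

definition vec_poly :: "nat \<Rightarrow> (pt \<Rightarrow> real^'m) set" where
  "vec_poly k = {p. \<exists>c :: nat \<Rightarrow> nat \<Rightarrow> real^'m.
     \<forall>x. p x = (\<Sum>i\<le>k. \<Sum>j\<le>k - i. (x $ 1 ^ i * x $ 2 ^ j) *\<^sub>R c i j)}"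

definition finite_dim_space :: "(pt \<Rightarrow> real^'m) set \<Rightarrow> bool" where
  "finite_dim_space V \<longleftrightarrow> (\<exists>B. finite B \<and> V = {\<lambda>x. \<Sum>b\<in>B. c b *\<^sub>R b x | c. True})"


section \<open>Polygons and meshes\<close>

definition area :: "pt set \<Rightarrow> real" where
  "area K = measure lebesgue K"

definition edges :: "pt set \<Rightarrow> pt set set" where
  "edges K = {e. e edge_of closure K}"

definition vertices :: "pt set \<Rightarrow> pt set" where
  "vertices K = {x. x extreme_point_of closure K}"

definition edge_length :: "pt set \<Rightarrow> real" where
  "edge_length e = diameter e"

text \<open>Integral with respect to arc length over a segment; it does not depend on the
  order of the end points.\<close>

definition edge_integral :: "pt set \<Rightarrow> (pt \<Rightarrow> real^'m) \<Rightarrow> real^'m" where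
  "edge_integral e \<phi> = (let (a, b) = (SOME (a, b). e = closed_segment a b) in
     edge_length e *\<^sub>R integral {0..1} (\<lambda>t. \<phi> (linepath a b t)))"

definition edge_mean :: "pt set \<Rightarrow> (pt \<Rightarrow> real^'m) \<Rightarrow> real^'m" where
  "edge_mean e \<phi> = (1 / edge_length e) *\<^sub>R edge_integral e \<phi>"

definition cell_mean :: "pt set \<Rightarrow> (pt \<Rightarrow> real^'m) \<Rightarrow> real^'m" where
  "cell_mean K \<phi> = (1 / area K) *\<^sub>R integral K \<phi>"

definition outward_normal :: "pt set \<Rightarrow> pt set \<Rightarrow> pt" where
  "outward_normal K e = (THE n. norm n = 1 \<and> (\<forall>p\<in>e. \<forall>q\<in>e. n \<bullet> (p - q) = 0) \<and>
     (\<forall>p\<in>e. \<forall>x\<in>K. n \<bullet> (x - p) \<le> 0))"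

definition interior_angle :: "pt set \<Rightarrow> pt \<Rightarrow> real" where
  "interior_angle K x = (THE \<theta>. \<exists>a b. a \<noteq> b \<and> closed_segment x a \<in> edges K \<and>
     closed_segment x b \<in> edges K \<and>
     \<theta> = arccos (((a - x) \<bullet> (b - x)) / (norm (a - x) * norm (b - x))))"

definition open_convex_polygon :: "pt set \<Rightarrow> bool" where
  "open_convex_polygon K \<longleftrightarrow> open K \<and> convex K \<and> K \<noteq> {} \<and> polytope (closure K)"

text \<open>For a single mesh, shape regularity and the bound on the number of edges are expressed
  with constants \<open>\<rho>\<close> and \<open>M\<close>; uniformity means that these do not depend on the mesh.\<close>

definition conforming_mesh :: "pt set \<Rightarrow> pt set set \<Rightarrow> real \<Rightarrow> nat \<Rightarrow> bool" where
  "conforming_mesh \<Omega> Th \<rho> M \<longleftrightarrow>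
     finite Th \<and> Th \<noteq> {} \<and>
     (\<forall>K\<in>Th. open_convex_polygon K \<and> K \<subseteq> \<Omega>) \<and>
     (\<forall>K\<in>Th. \<forall>K'\<in>Th. K \<noteq> K' \<longrightarrow> K \<inter> K' = {}) \<and>
     closure \<Omega> = (\<Union>K\<in>Th. closure K) \<and>
     (\<forall>K\<in>Th. \<forall>K'\<in>Th. (closure K \<inter> closure K') face_of closure K) \<and>
     \<rho> > 0 \<and> (\<forall>K\<in>Th. \<exists>x. ball x (\<rho> * diameter K) \<subseteq> K) \<and>
     (\<forall>K\<in>Th. card (edges K) \<le> M)"


section \<open>Data of the hybrid scheme\<close>

record ('m::finite) hybrid =
  avg :: "pt set \<Rightarrow> real^'m"
  pv :: "pt \<Rightarrow> real^'m"

datatype limiter_kind = Classic | Alternative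

datatype side = MinusSide | PlusSide | ExtSide

text \<open>
  Nodes are identified with their coordinates and edges with closed segments, so that a
  shared edge is the same object for both of its cells.  The boundary data are
  \<open>bdry_state u e \<nu>\<close>, the exterior state for the numerical flux, and \<open>bdry_grad u \<sigma> e s\<close>,
  the gradient of the exterior data replacing the reconstruction on side \<open>s\<close> of
  \<open>e\<close> at the node \<open>\<sigma>\<close> where a cell is missing.  The unit tangent \<open>tang \<sigma> e\<close> at a midpoint
  \<open>\<sigma>\<close> may point either way; \<open>ext_cell\<close> records the tie-breaking for the exterior cell.
\<close>

record ('m::finite, 'j) scheme =
  flux :: "2 \<Rightarrow> real^'m \<Rightarrow> real^'m"
  con_index :: "'j set"
  con :: "'j \<Rightarrow> real^'m \<Rightarrow> real"
  lf_speed :: "real^'m \<Rightarrow> pt \<Rightarrow> real"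
  lf_zeta :: "'j \<Rightarrow> real^'m \<Rightarrow> pt"
  domain :: "pt set"
  cells :: "pt set set"
  shape_const :: real
  edge_bound :: nat
  degree_k :: nat
  W :: "pt set \<Rightarrow> (pt \<Rightarrow> real^'m) set"
  rec_op :: "pt set \<Rightarrow> 'm hybrid \<Rightarrow> pt \<Rightarrow> real^'m"
  Nq :: nat
  qnode :: "pt set \<Rightarrow> nat \<Rightarrow> pt"
  qweight :: "pt set \<Rightarrow> nat \<Rightarrow> real"
  kind :: limiter_kind
  cad_edge :: "pt set \<Rightarrow> pt set \<Rightarrow> real"
  cad_num :: "pt set \<Rightarrow> nat"
  cad_int :: "pt set \<Rightarrow> nat \<Rightarrow> real"
  cad_node :: "pt set \<Rightarrow> nat \<Rightarrow> pt"
  visc :: "'m hybrid \<Rightarrow> pt set \<Rightarrow> pt set \<Rightarrow> nat \<Rightarrow> real"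
  bdry_state :: "'m hybrid \<Rightarrow> pt set \<Rightarrow> nat \<Rightarrow> real^'m"
  trans :: "real^'m \<Rightarrow> real^'m"
  btrans :: "real^'m \<Rightarrow> real^'m"
  U_fwd :: "(real^'m) set"
  G_pt :: "(real^'m) set"
  tang :: "pt \<Rightarrow> pt set \<Rightarrow> pt"
  ext_cell :: "pt \<Rightarrow> pt set \<Rightarrow> pt set option"
  pt_speed :: "'m hybrid \<Rightarrow> pt \<Rightarrow> real"
  bdry_grad :: "'m hybrid \<Rightarrow> pt \<Rightarrow> pt set \<Rightarrow> side \<Rightarrow> real^2^'m"


section \<open>Conservation law and invariant domain\<close>

definition flux_dir :: "('m::finite, 'j) scheme \<Rightarrow> real^'m \<Rightarrow> pt \<Rightarrow> real^'m" where
  "flux_dir S u n = (\<Sum>i\<in>UNIV. n $ i *\<^sub>R flux S i u)"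

definition A_dir :: "('m::finite, 'j) scheme \<Rightarrow> pt \<Rightarrow> real^'m \<Rightarrow> real^'m^'m" where
  "A_dir S q u = (\<Sum>i\<in>UNIV. q $ i *\<^sub>R jacobian (flux S i) u)"

definition G_int :: "('m::finite, 'j) scheme \<Rightarrow> (real^'m) set" where
  "G_int S = {u. \<forall>j\<in>con_index S. con S j u > 0}"

definition G_set :: "('m::finite, 'j) scheme \<Rightarrow> (real^'m) set" where
  "G_set S = closure (G_int S)"

definition S_bd :: "('m::finite, 'j) scheme \<Rightarrow> 'j \<Rightarrow> (real^'m) set" where
  "S_bd S j = frontier (G_set S) \<inter> frontier {u. con S j u \<ge> 0}"

definition hyperbolic_law :: "('m::finite, 'j) scheme \<Rightarrow> bool" where
  "hyperbolic_law S \<longleftrightarrow> (\<forall>u\<in>G_int S. (\<forall>i. flux S i differentiable (at u)) \<and>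
     (\<forall>q. real_diagonalizable (A_dir S q u)))"

definition invariant_domain :: "('m::finite, 'j) scheme \<Rightarrow> bool" where
  "invariant_domain S \<longleftrightarrow>
     finite (con_index S) \<and>
     G_set S = {u. \<forall>j\<in>con_index S. con S j u \<ge> 0} \<and>
     convex (G_set S) \<and>
     (\<forall>j\<in>con_index S. concave_on (G_set S) (con S j)) \<and>
     (\<forall>j\<in>con_index S. \<exists>D. open D \<and> G_set S \<subseteq> D \<and>
        (\<forall>u\<in>D. con S j differentiable (at u)) \<and> continuous_on D (grad (con S j))) \<and>
     (\<forall>j\<in>con_index S. \<forall>u\<in>S_bd S j. grad (con S j) u \<noteq> 0) \<and>
     G_set S = {u. \<forall>j\<in>con_index S. \<forall>us\<in>S_bd S j. (u - us) \<bullet> grad (con S j) us \<ge> 0}"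

definition weak_LF_splitting :: "('m::finite, 'j) scheme \<Rightarrow> bool" where
  "weak_LF_splitting S \<longleftrightarrow>
     (\<forall>u\<in>G_set S. \<forall>n. norm n = 1 \<longrightarrow> lf_speed S u n \<ge> 0) \<and>
     (\<forall>u\<in>G_set S. \<forall>j\<in>con_index S. \<forall>us\<in>S_bd S j. \<forall>n \<alpha>.
        norm n = 1 \<and> \<alpha> \<ge> lf_speed S u n \<longrightarrow>
        (let ns = grad (con S j) us in
          \<alpha> * ((u - us) \<bullet> ns) + flux_dir S u n \<bullet> ns \<ge> - (lf_zeta S j us \<bullet> n) \<and>
          \<alpha> * ((u - us) \<bullet> ns) - flux_dir S u n \<bullet> ns \<ge> lf_zeta S j us \<bullet> n))"


section \<open>Nodes, reconstruction, quadrature, cell average decomposition\<close>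

definition all_edges :: "('m::finite, 'j) scheme \<Rightarrow> pt set set" where
  "all_edges S = (\<Union>K\<in>cells S. edges K)"

definition vertex_nodes :: "('m::finite, 'j) scheme \<Rightarrow> pt set" where
  "vertex_nodes S = (\<Union>K\<in>cells S. vertices K)"

definition midpoint_nodes :: "('m::finite, 'j) scheme \<Rightarrow> pt set" where
  "midpoint_nodes S = {midpoint a b | a b. closed_segment a b \<in> all_edges S}"

definition nodes :: "('m::finite, 'j) scheme \<Rightarrow> pt set" where
  "nodes S = vertex_nodes S \<union> midpoint_nodes S"

definition cell_nodes :: "('m::finite, 'j) scheme \<Rightarrow> pt set \<Rightarrow> pt set" where
  "cell_nodes S K = {x \<in> nodes S. x \<in> frontier K}"

definition reconstruction_ok :: "('m::finite, 'j) scheme \<Rightarrow> bool" where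
  "reconstruction_ok S \<longleftrightarrow> (\<forall>K\<in>cells S.
     finite_dim_space (W S K) \<and> vec_poly (degree_k S) \<subseteq> W S K \<and>
     (\<forall>\<phi>\<in>W S K. \<exists>D. closure K \<subseteq> D \<and> smooth_on D \<phi>) \<and>
     (\<forall>u. rec_op S K u \<in> W S K \<and> cell_mean K (rec_op S K u) = avg u K \<and>
        (\<forall>x\<in>cell_nodes S K. rec_op S K u x = pv u x)))"

definition quadrature_ok :: "('m::finite, 'j) scheme \<Rightarrow> bool" where
  "quadrature_ok S \<longleftrightarrow> (\<forall>e\<in>all_edges S.
     (\<forall>\<nu>\<in>{1..Nq S}. qnode S e \<nu> \<in> e \<inter> nodes S \<and> qweight S e \<nu> > 0) \<and>
     (\<Sum>\<nu>=1..Nq S. qweight S e \<nu>) = 1) \<and>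
   (\<forall>K\<in>cells S. \<forall>e\<in>edges K. \<forall>\<phi>\<in>W S K.
     (\<Sum>\<nu>=1..Nq S. qweight S e \<nu> *\<^sub>R \<phi> (qnode S e \<nu>)) = edge_mean e \<phi>)"

definition cad_exact_on :: "('m::finite, 'j) scheme \<Rightarrow> pt set \<Rightarrow> (pt \<Rightarrow> real^'m) set \<Rightarrow> bool" where
  "cad_exact_on S K V \<longleftrightarrow> (\<forall>\<phi>\<in>V. cell_mean K \<phi> =
     (\<Sum>e\<in>edges K. cad_edge S K e *\<^sub>R edge_mean e \<phi>) +
     (\<Sum>s=1..cad_num S K. cad_int S K s *\<^sub>R \<phi> (cad_node S K s)))"

definition cad_edge_sum :: "('m::finite, 'j) scheme \<Rightarrow> pt set \<Rightarrow> real" where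
  "cad_edge_sum S K = (\<Sum>e\<in>edges K. cad_edge S K e)"

definition cad_space :: "('m::finite, 'j) scheme \<Rightarrow> pt set \<Rightarrow> (pt \<Rightarrow> real^'m) set" where
  "cad_space S K = (case kind S of Classic \<Rightarrow> W S K | Alternative \<Rightarrow> vec_poly (degree_k S))"

definition cad_ok :: "('m::finite, 'j) scheme \<Rightarrow> bool" where
  "cad_ok S \<longleftrightarrow> (\<forall>K\<in>cells S.
     (\<forall>e\<in>edges K. cad_edge S K e > 0) \<and>
     (\<forall>s\<in>{1..cad_num S K}. cad_int S K s > 0 \<and> cad_node S K s \<in> closure K) \<and>
     cad_edge_sum S K + (\<Sum>s=1..cad_num S K. cad_int S K s) = 1 \<and>
     cad_exact_on S K (cad_space S K))"

text \<open>
  A decomposition without interior part that is exact only on polynomials says nothing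
  about \<open>\<open>\<hat>u\<close>\<^sub>K \<in> W\<^sub>K\<close>, since \<open>G\<close>-admissibility constrains only edge values in that case.  Such a
  decomposition exists for degree one on a triangle (all edge weights \<open>1/3\<close>), and then
  cell averages can leave \<open>G\<close>.  The condition below excludes this.  It holds automatically for
  the classic limiter, and for degrees at least two, where the edge weights of a
  decomposition exact on quadratics always sum to less than one.
\<close>

definition cad_edge_only_exact :: "('m::finite, 'j) scheme \<Rightarrow> bool" where
  "cad_edge_only_exact S \<longleftrightarrow>
     (\<forall>K\<in>cells S. cad_edge_sum S K = 1 \<longrightarrow> cad_exact_on S K (W S K))"

definition mu :: "('m::finite, 'j) scheme \<Rightarrow> pt set \<Rightarrow> real" where
  "mu S K = Min ((\<lambda>e. cad_edge S K e * area K / edge_length e) ` edges K)"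


section \<open>Limiter\<close>

definition edge_sample :: "('m::finite, 'j) scheme \<Rightarrow> pt set \<Rightarrow> (pt \<Rightarrow> real^'m) \<Rightarrow> real^'m" where
  "edge_sample S K \<phi> = (\<Sum>e\<in>edges K. cad_edge S K e *\<^sub>R
     (\<Sum>\<nu>=1..Nq S. qweight S e \<nu> *\<^sub>R \<phi> (qnode S e \<nu>)))"

definition G_admissible ::
    "('m::finite, 'j) scheme \<Rightarrow> pt set \<Rightarrow> real^'m \<Rightarrow> (pt \<Rightarrow> real^'m) \<Rightarrow> bool" where
  "G_admissible S K ubar \<phi> \<longleftrightarrow> \<phi> \<in> W S K \<and>
     (\<forall>e\<in>edges K. \<forall>\<nu>\<in>{1..Nq S}. \<phi> (qnode S e \<nu>) \<in> G_set S) \<and>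
     (cad_edge_sum S K < 1 \<longrightarrow>
        (1 / (1 - cad_edge_sum S K)) *\<^sub>R (ubar - edge_sample S K \<phi>) \<in> G_set S)"

definition edge_qnodes :: "('m::finite, 'j) scheme \<Rightarrow> pt set \<Rightarrow> pt set" where
  "edge_qnodes S K = {qnode S e \<nu> | e \<nu>. e \<in> edges K \<and> \<nu> \<in> {1..Nq S}}"

definition ustar :: "('m::finite, 'j) scheme \<Rightarrow> pt set \<Rightarrow> real^'m \<Rightarrow> (pt \<Rightarrow> real^'m) \<Rightarrow> real^'m" where
  "ustar S K ubar \<phi> = (1 / (1 - cad_edge_sum S K)) *\<^sub>R
     (ubar - (\<Sum>e\<in>edges K. cad_edge S K e *\<^sub>R edge_mean e \<phi>))"

definition limited_states ::
    "('m::finite, 'j) scheme \<Rightarrow> pt set \<Rightarrow> real^'m \<Rightarrow> (pt \<Rightarrow> real^'m) \<Rightarrow> (real^'m) set" where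
  "limited_states S K ubar \<phi> = (case kind S of
     Classic \<Rightarrow> \<phi> ` (edge_qnodes S K \<union> cad_node S K ` {1..cad_num S K})
   | Alternative \<Rightarrow> \<phi> ` edge_qnodes S K \<union>
       (if cad_edge_sum S K < 1 then {ustar S K ubar \<phi>} else {}))"

definition theta :: "('m::finite, 'j) scheme \<Rightarrow> pt set \<Rightarrow> real^'m \<Rightarrow> (pt \<Rightarrow> real^'m) \<Rightarrow> real" where
  "theta S K ubar \<phi> = Sup {t \<in> {0..1}.
     \<forall>v\<in>limited_states S K ubar \<phi>. ubar + t *\<^sub>R (v - ubar) \<in> G_set S}"

definition limiter ::
    "('m::finite, 'j) scheme \<Rightarrow> pt set \<Rightarrow> (pt \<Rightarrow> real^'m) \<Rightarrow> real^'m \<Rightarrow> pt \<Rightarrow> real^'m" where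
  "limiter S K \<phi> ubar x = ubar + theta S K ubar \<phi> *\<^sub>R (\<phi> x - ubar)"

definition uhat :: "('m::finite, 'j) scheme \<Rightarrow> 'm hybrid \<Rightarrow> pt set \<Rightarrow> pt \<Rightarrow> real^'m" where
  "uhat S u K = limiter S K (rec_op S K u) (avg u K)"

definition limited_admissible :: "('m::finite, 'j) scheme \<Rightarrow> 'm hybrid \<Rightarrow> bool" where
  "limited_admissible S u \<longleftrightarrow> (\<forall>K\<in>cells S. G_admissible S K (avg u K) (uhat S u K))"


section \<open>Conservative operator\<close>

definition is_neighbour :: "('m::finite, 'j) scheme \<Rightarrow> pt set \<Rightarrow> pt set \<Rightarrow> pt set \<Rightarrow> bool" where
  "is_neighbour S K e K' \<longleftrightarrow> K' \<in> cells S \<and> K' \<noteq> K \<and> e \<in> edges K'"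

definition outer_state ::
    "('m::finite, 'j) scheme \<Rightarrow> 'm hybrid \<Rightarrow> pt set \<Rightarrow> pt set \<Rightarrow> nat \<Rightarrow> real^'m" where
  "outer_state S u K e \<nu> =
     (if \<exists>K'. is_neighbour S K e K'
      then uhat S u (SOME K'. is_neighbour S K e K') (qnode S e \<nu>)
      else bdry_state S u e \<nu>)"

definition boundary_states_ok :: "('m::finite, 'j) scheme \<Rightarrow> bool" where
  "boundary_states_ok S \<longleftrightarrow> (\<forall>u. \<forall>K\<in>cells S. \<forall>e\<in>edges K. \<forall>\<nu>\<in>{1..Nq S}.
     \<not> (\<exists>K'. is_neighbour S K e K') \<longrightarrow> bdry_state S u e \<nu> \<in> G_set S)"

definition visc_ok :: "('m::finite, 'j) scheme \<Rightarrow> bool" where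
  "visc_ok S \<longleftrightarrow> (\<forall>u. limited_admissible S u \<longrightarrow>
     (\<forall>K\<in>cells S. \<forall>e\<in>edges K. \<forall>\<nu>\<in>{1..Nq S}.
        visc S u K e \<nu> \<ge> max (lf_speed S (uhat S u K (qnode S e \<nu>)) (outward_normal K e))
                               (lf_speed S (outer_state S u K e \<nu>) (outward_normal K e))))"

definition L_op :: "('m::finite, 'j) scheme \<Rightarrow> 'm hybrid \<Rightarrow> pt set \<Rightarrow> real^'m" where
  "L_op S u K = - (1 / area K) *\<^sub>R (\<Sum>e\<in>edges K. edge_length e *\<^sub>R
     (\<Sum>\<nu>=1..Nq S. qweight S e \<nu> *\<^sub>R
       (let ui = uhat S u K (qnode S e \<nu>); ue = outer_state S u K e \<nu>; n = outward_normal K e in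
         (1/2) *\<^sub>R (flux_dir S ui n + flux_dir S ue n)
         - (visc S u K e \<nu> / 2) *\<^sub>R (ue - ui))))"

definition alpha_cell :: "('m::finite, 'j) scheme \<Rightarrow> 'm hybrid \<Rightarrow> pt set \<Rightarrow> real" where
  "alpha_cell S u K = Max {lf_speed S (uhat S u K (qnode S e \<nu>)) (outward_normal K e) | e \<nu>.
     e \<in> edges K \<and> \<nu> \<in> {1..Nq S}}"

text \<open>The condition \<open>\<tau> \<le> \<mu>\<^sub>K / (2 \<alpha>\<^sub>K)\<close> in product form, so that a cell with \<open>\<alpha>\<^sub>K = 0\<close> imposes
  no restriction (in HOL the quotient would be \<open>0\<close>).\<close>

definition conservative_CFL :: "('m::finite, 'j) scheme \<Rightarrow> 'm hybrid \<Rightarrow> real \<Rightarrow> bool" where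
  "conservative_CFL S u \<tau> \<longleftrightarrow> (\<forall>K\<in>cells S. \<tau> * (2 * alpha_cell S u K) \<le> mu S K)"

text \<open>
  The constant \<open>\<alpha>\<^sub>K\<close> above involves only the speeds of the interior traces, whereas the numerical
  viscosities \<open>\<alpha>\<^sub>K\<^sub>,\<^sub>e\<^sub>,\<^sub>\<nu>\<close> are bounded only from below and also see the exterior traces.  With zero
  flux and \<open>lf_speed = 0\<close>, every \<open>\<tau>\<close> satisfies the CFL condition for arbitrarily large viscosity, and
  the cell averages leave \<open>G\<close>.  The step therefore also has to resolve the viscosity; this follows
  from the CFL condition wherever \<open>\<alpha>\<^sub>K\<^sub>,\<^sub>e\<^sub>,\<^sub>\<nu> \<le> 3 \<alpha>\<^sub>K\<close>, since then
  \<open>\<tau> \<alpha>\<^sub>K\<^sub>,\<^sub>e\<^sub>,\<^sub>\<nu> \<le> 3 \<tau> \<alpha>\<^sub>K \<le> 3/2 \<mu>\<^sub>K\<close>.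
\<close>

definition visc_resolved :: "('m::finite, 'j) scheme \<Rightarrow> 'm hybrid \<Rightarrow> real \<Rightarrow> bool" where
  "visc_resolved S u \<tau> \<longleftrightarrow> (\<forall>K\<in>cells S. \<forall>e\<in>edges K. \<forall>\<nu>\<in>{1..Nq S}.
     \<tau> * visc S u K e \<nu> \<le> 3/2 * mu S K)"


section \<open>Point transform and point operator\<close>

definition J_mat :: "('m::finite, 'j) scheme \<Rightarrow> pt \<Rightarrow> real^'m \<Rightarrow> real^'m^'m" where
  "J_mat S q u = jacobian (trans S) u ** A_dir S q u ** matrix_inv (jacobian (trans S) u)"

definition time_deriv :: "(real \<times> pt \<Rightarrow> real^'m) \<Rightarrow> real \<times> pt \<Rightarrow> real^'m" where
  "time_deriv u z = frechet_derivative u (at z) (1, 0)"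

definition space_deriv :: "2 \<Rightarrow> (real \<times> pt \<Rightarrow> real^'m) \<Rightarrow> real \<times> pt \<Rightarrow> real^'m" where
  "space_deriv i u z = frechet_derivative u (at z) (0, axis i 1)"

definition exact_setting :: "('m::finite, 'j) scheme \<Rightarrow> bool" where
  "exact_setting S \<longleftrightarrow>
     U_fwd S = G_int S \<and> G_pt S = G_int S \<and>
     bij_betw (trans S) (G_int S) UNIV \<and>
     (\<forall>w. btrans S w \<in> G_int S \<and> trans S (btrans S w) = w) \<and>
     (\<forall>u\<in>G_int S. trans S differentiable (at u) \<and> invertible (jacobian (trans S) u)) \<and>
     continuous_on (G_int S) (jacobian (trans S)) \<and>
     locally_lipschitz_on (G_int S) (trans S) \<and> locally_lipschitz_on UNIV (btrans S) \<and>
     (\<forall>Q u. smooth_on Q u \<and> u ` Q \<subseteq> G_int S \<and>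
        (\<forall>z\<in>Q. time_deriv u z + (\<Sum>i\<in>UNIV. space_deriv i (\<lambda>y. flux S i (u y)) z) = 0) \<longrightarrow>
        (\<forall>z\<in>Q. time_deriv (\<lambda>y. trans S (u y)) z +
           (\<Sum>i\<in>UNIV. J_mat S (axis i 1) (u z) *v space_deriv i (\<lambda>y. trans S (u y)) z) = 0))"

definition practical_setting :: "('m::finite, 'j) scheme \<Rightarrow> bool" where
  "practical_setting S \<longleftrightarrow>
     range (btrans S) = G_pt S \<and> convex (G_pt S) \<and> G_pt S \<subseteq> U_fwd S"

definition hybrid_admissible :: "('m::finite, 'j) scheme \<Rightarrow> 'm hybrid \<Rightarrow> bool" where
  "hybrid_admissible S u \<longleftrightarrow>
     (\<forall>K\<in>cells S. avg u K \<in> G_set S) \<and> (\<forall>\<sigma>\<in>nodes S. pv u \<sigma> \<in> G_pt S)"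

definition transform_defined :: "('m::finite, 'j) scheme \<Rightarrow> 'm hybrid \<Rightarrow> bool" where
  "transform_defined S u \<longleftrightarrow> (\<forall>\<sigma>\<in>nodes S. pv u \<sigma> \<in> U_fwd S \<and>
     (\<forall>i. flux S i differentiable (at (pv u \<sigma>))) \<and>
     trans S differentiable (at (pv u \<sigma>)) \<and> invertible (jacobian (trans S) (pv u \<sigma>)))"

definition node_edges :: "('m::finite, 'j) scheme \<Rightarrow> pt \<Rightarrow> pt set set" where
  "node_edges S \<sigma> = {e \<in> all_edges S. \<sigma> \<in> e}"

text \<open>\<open>(node_normal, tang)\<close> is a right-handed orthonormal basis.\<close>

definition node_normal :: "('m::finite, 'j) scheme \<Rightarrow> pt \<Rightarrow> pt set \<Rightarrow> pt" where
  "node_normal S \<sigma> e = vector [tang S \<sigma> e $ 2, - (tang S \<sigma> e $ 1)]"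

definition some_cell :: "(pt set \<Rightarrow> bool) \<Rightarrow> pt set option" where
  "some_cell P = (if \<exists>K. P K then Some (SOME K. P K) else None)"

definition minus_cell :: "('m::finite, 'j) scheme \<Rightarrow> pt \<Rightarrow> pt set \<Rightarrow> pt set option" where
  "minus_cell S \<sigma> e = some_cell (\<lambda>K. K \<in> cells S \<and> e \<in> edges K \<and>
     outward_normal K e = node_normal S \<sigma> e)"

definition plus_cell :: "('m::finite, 'j) scheme \<Rightarrow> pt \<Rightarrow> pt set \<Rightarrow> pt set option" where
  "plus_cell S \<sigma> e = some_cell (\<lambda>K. K \<in> cells S \<and> e \<in> edges K \<and>
     outward_normal K e = - node_normal S \<sigma> e)"

text \<open>Closures of cells are used because the upwind ray may run along an edge; this is the tie.\<close>

definition ext_candidates :: "('m::finite, 'j) scheme \<Rightarrow> pt \<Rightarrow> pt set \<Rightarrow> pt set set" where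
  "ext_candidates S \<sigma> e = {K \<in> cells S. \<exists>\<epsilon>0>0. \<forall>\<epsilon>\<in>{0<..<\<epsilon>0}. \<sigma> - \<epsilon> *\<^sub>R tang S \<sigma> e \<in> closure K}"

definition node_geometry_ok :: "('m::finite, 'j) scheme \<Rightarrow> bool" where
  "node_geometry_ok S \<longleftrightarrow> (\<forall>\<sigma>\<in>nodes S. \<forall>e\<in>node_edges S \<sigma>.
     norm (tang S \<sigma> e) = 1 \<and> (\<exists>\<epsilon>>0. \<sigma> + \<epsilon> *\<^sub>R tang S \<sigma> e \<in> e) \<and>
     (\<sigma> \<in> vertex_nodes S \<longrightarrow>
       (case ext_cell S \<sigma> e of None \<Rightarrow> ext_candidates S \<sigma> e = {}
                              | Some K \<Rightarrow> K \<in> ext_candidates S \<sigma> e)))"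

definition half_angle :: "('m::finite, 'j) scheme \<Rightarrow> pt \<Rightarrow> pt set \<Rightarrow> real" where
  "half_angle S \<sigma> e = (\<Sum>K | K \<in> cells S \<and> e \<in> edges K. interior_angle K \<sigma>) / 2"

definition node_weight :: "('m::finite, 'j) scheme \<Rightarrow> pt \<Rightarrow> pt set \<Rightarrow> real" where
  "node_weight S \<sigma> e = half_angle S \<sigma> e / (\<Sum>e'\<in>node_edges S \<sigma>. half_angle S \<sigma> e')"

definition pt_speed_ok :: "('m::finite, 'j) scheme \<Rightarrow> bool" where
  "pt_speed_ok S \<longleftrightarrow> (\<forall>u. hybrid_admissible S u \<longrightarrow> (\<forall>\<sigma>\<in>nodes S. pt_speed S u \<sigma> > 0 \<and>
     (\<forall>e\<in>node_edges S \<sigma>.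
        spectral_radius (J_mat S (node_normal S \<sigma> e) (pv u \<sigma>)) \<le> pt_speed S u \<sigma> \<and>
        spectral_radius (J_mat S (tang S \<sigma> e) (pv u \<sigma>)) \<le> pt_speed S u \<sigma>)))"

definition J_plus :: "('m::finite, 'j) scheme \<Rightarrow> 'm hybrid \<Rightarrow> pt \<Rightarrow> pt \<Rightarrow> real^'m^'m" where
  "J_plus S u \<sigma> q = (1/2) *\<^sub>R (J_mat S q (pv u \<sigma>) + pt_speed S u \<sigma> *\<^sub>R mat 1)"

definition J_minus :: "('m::finite, 'j) scheme \<Rightarrow> 'm hybrid \<Rightarrow> pt \<Rightarrow> pt \<Rightarrow> real^'m^'m" where
  "J_minus S u \<sigma> q = (1/2) *\<^sub>R (J_mat S q (pv u \<sigma>) - pt_speed S u \<sigma> *\<^sub>R mat 1)"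

text \<open>Directional derivative of the transformed variable, taken from the unlimited reconstruction
  on the given cell, or from the boundary data if that cell is missing.\<close>

definition dw :: "('m::finite, 'j) scheme \<Rightarrow> 'm hybrid \<Rightarrow> pt \<Rightarrow> pt set \<Rightarrow> side \<Rightarrow>
    pt set option \<Rightarrow> pt \<Rightarrow> real^'m" where
  "dw S u \<sigma> e s Ko q = jacobian (trans S) (pv u \<sigma>) *v
     (case Ko of Some K \<Rightarrow> frechet_derivative (rec_op S K u) (at \<sigma>) q
               | None \<Rightarrow> bdry_grad S u \<sigma> e s *v q)"

definition D_pt :: "('m::finite, 'j) scheme \<Rightarrow> 'm hybrid \<Rightarrow> pt \<Rightarrow> real^'m" where
  "D_pt S u \<sigma> =
     (if \<sigma> \<in> vertex_nodes S then
        - (\<Sum>e\<in>node_edges S \<sigma>. node_weight S \<sigma> e *\<^sub>R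
            (let n = node_normal S \<sigma> e; t = tang S \<sigma> e;
                 Km = minus_cell S \<sigma> e; Kp = plus_cell S \<sigma> e; Kx = ext_cell S \<sigma> e in
              J_plus S u \<sigma> n *v dw S u \<sigma> e MinusSide Km n +
              J_minus S u \<sigma> n *v dw S u \<sigma> e PlusSide Kp n +
              J_minus S u \<sigma> t *v dw S u \<sigma> e MinusSide Km t +
              J_plus S u \<sigma> t *v dw S u \<sigma> e ExtSide Kx t))
      else
        - (let e = (THE e. e \<in> node_edges S \<sigma>); n = node_normal S \<sigma> e; t = tang S \<sigma> e;
               Km = minus_cell S \<sigma> e; Kp = plus_cell S \<sigma> e in
            J_plus S u \<sigma> n *v dw S u \<sigma> e MinusSide Km n +
            J_minus S u \<sigma> n *v dw S u \<sigma> e PlusSide Kp n +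
            J_mat S t (pv u \<sigma>) *v dw S u \<sigma> e MinusSide Km t))"

definition hybrid_dist :: "('m::finite, 'j) scheme \<Rightarrow> 'm hybrid \<Rightarrow> 'm hybrid \<Rightarrow> real" where
  "hybrid_dist S u v = (\<Sum>K\<in>cells S. norm (avg u K - avg v K)) +
     (\<Sum>\<sigma>\<in>nodes S. norm (pv u \<sigma> - pv v \<sigma>))"

definition boundary_gradients_ok :: "('m::finite, 'j) scheme \<Rightarrow> bool" where
  "boundary_gradients_ok S \<longleftrightarrow> (\<forall>\<sigma>\<in>nodes S. \<forall>e\<in>node_edges S \<sigma>. \<forall>s.
     \<forall>u. hybrid_admissible S u \<longrightarrow> (\<exists>r>0. \<exists>L. \<forall>v v'.
       hybrid_admissible S v \<and> hybrid_admissible S v' \<and>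
       hybrid_dist S u v \<le> r \<and> hybrid_dist S u v' \<le> r \<longrightarrow>
       norm (bdry_grad S v \<sigma> e s - bdry_grad S v' \<sigma> e s) \<le> L * hybrid_dist S v v'))"

definition hybrid_setting :: "('m::finite, 'j) scheme \<Rightarrow> bool" where
  "hybrid_setting S \<longleftrightarrow>
     hyperbolic_law S \<and> invariant_domain S \<and> weak_LF_splitting S \<and>
     conforming_mesh (domain S) (cells S) (shape_const S) (edge_bound S) \<and>
     reconstruction_ok S \<and> quadrature_ok S \<and> cad_ok S \<and>
     boundary_states_ok S \<and> visc_ok S \<and>
     node_geometry_ok S \<and> pt_speed_ok S \<and> boundary_gradients_ok S"


section \<open>SSP Runge--Kutta methods\<close>

text \<open>\<open>U 0, \<dots>, U s\<close> are the stage states of an \<open>s\<close>-stage method; stages are prescribed only at the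
  cells and nodes of the mesh.\<close>

definition ssp_stages :: "('m::finite, 'j) scheme \<Rightarrow> nat \<Rightarrow> (nat \<Rightarrow> nat \<Rightarrow> real) \<Rightarrow>
    (nat \<Rightarrow> nat \<Rightarrow> real) \<Rightarrow> real \<Rightarrow> (nat \<Rightarrow> 'm hybrid) \<Rightarrow> bool" where
  "ssp_stages S s a c dt U \<longleftrightarrow> (\<forall>i\<in>{1..s}.
     (\<forall>j<i. a i j \<ge> 0 \<and> c i j \<ge> 0) \<and> (\<Sum>j<i. a i j) = 1 \<and>
     (\<forall>K\<in>cells S. avg (U i) K =
        (\<Sum>j<i. a i j *\<^sub>R (avg (U j) K + (c i j * dt) *\<^sub>R L_op S (U j) K))) \<and>
     (\<forall>\<sigma>\<in>nodes S. pv (U i) \<sigma> = btrans S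
        (\<Sum>j<i. a i j *\<^sub>R (trans S (pv (U j) \<sigma>) + (c i j * dt) *\<^sub>R D_pt S (U j) \<sigma>))))"

definition ssprk3_step :: "('m::finite, 'j) scheme \<Rightarrow> real \<Rightarrow> 'm hybrid \<Rightarrow> 'm hybrid \<Rightarrow>
    'm hybrid \<Rightarrow> 'm hybrid \<Rightarrow> bool" where
  "ssprk3_step S dt u0 u1 u2 u3 \<longleftrightarrow>
     (\<forall>K\<in>cells S.
        avg u1 K = avg u0 K + dt *\<^sub>R L_op S u0 K \<and>
        avg u2 K = (3/4) *\<^sub>R avg u0 K + (1/4) *\<^sub>R (avg u1 K + dt *\<^sub>R L_op S u1 K) \<and>
        avg u3 K = (1/3) *\<^sub>R avg u0 K + (2/3) *\<^sub>R (avg u2 K + dt *\<^sub>R L_op S u2 K)) \<and>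
     (\<forall>\<sigma>\<in>nodes S. let w0 = trans S (pv u0 \<sigma>); w1 = trans S (pv u1 \<sigma>); w2 = trans S (pv u2 \<sigma>) in
        pv u1 \<sigma> = btrans S (w0 + dt *\<^sub>R D_pt S u0 \<sigma>) \<and>
        pv u2 \<sigma> = btrans S ((3/4) *\<^sub>R w0 + (1/4) *\<^sub>R (w1 + dt *\<^sub>R D_pt S u1 \<sigma>)) \<and>
        pv u3 \<sigma> = btrans S ((1/3) *\<^sub>R w0 + (2/3) *\<^sub>R (w2 + dt *\<^sub>R D_pt S u2 \<sigma>)))"

end

theory Submission
  imports Defs
begin

text \<open>
  For the point values there is nothing to estimate: each new one is an image under
  \<^const>\<open>btrans\<close>, whose range lies in \<^const>\<open>G_pt\<close> in both settings.  All the work concerns the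
  cell averages, and since \<open>G\<close> is convex it suffices to treat one forward Euler step
  (\<open>forward_Euler_average\<close>).

  \<open>G\<close> is an intersection of half-spaces \<open>{u. (u - u\<^sup>*) \<bullet> \<xi> \<ge> 0}\<close>, so fix one of them and follow
  the affine function \<open>h u = (u - u\<^sup>*) \<bullet> \<xi>\<close>.  The cell average decomposition bounds
  \<open>h\<close> of the average from below by the weighted sum of \<open>h\<close> over the edge traces
  (\<open>edge_sample_le_avg\<close>).  At each quadrature node, the weak Lax--Friedrichs splitting for the
  exterior trace, used with the numerical viscosity, absorbs that trace completely; the
  splitting for the interior trace, used with its own speed, costs only a multiple of
  \<open>h\<close> of that trace, and the two step size conditions make this multiple at most the weight
  of the trace in the decomposition.  What is left over are the terms \<open>\<zeta> \<bullet> n\<close>, multiplied by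
  edge lengths.  They do not depend on the states and sum to zero over the cell, because
  \<open>\<Sum> |e| n\<^sub>e = 0\<close> for a closed polygon (\<open>sum_edge_length_outward_normal\<close>).

  This polygon identity is proved combinatorially.  A quarter turn maps \<open>|e| n\<^sub>e\<close> to the vector
  from the tail to the head of \<open>e\<close>, where \<open>e\<close> is oriented with the cell on its left.  Every vertex
  is the tail of exactly one edge and the head of exactly one, so the sum of all heads equals
  the sum of all tails.
\<close>

section \<open>Closed polygons: the outward normals, weighted by edge length, sum to zero\<close>

definition quarter_turn :: "pt \<Rightarrow> pt" where
  "quarter_turn n = vector [- (n $ 2), n $ 1]"

lemma quarter_turn_nth [simp]:
  "quarter_turn n $ 1 = - (n $ 2)" "quarter_turn n $ 2 = n $ 1"
  by (simp_all add: quarter_turn_def)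

lemma inner_pt: "(x::pt) \<bullet> y = x $ 1 * y $ 1 + x $ 2 * y $ 2"
  by (simp add: inner_vec_def sum_2)

lemma pt_eq_iff: "(x::pt) = y \<longleftrightarrow> x $ 1 = y $ 1 \<and> x $ 2 = y $ 2"
  by (simp add: vec_eq_iff forall_2)

lemma linear_quarter_turn: "linear quarter_turn"
  by (rule linearI) (simp_all add: pt_eq_iff)

lemma quarter_turn_inner_quarter_turn [simp]: "quarter_turn n \<bullet> quarter_turn m = n \<bullet> m"
  by (simp add: inner_pt)

lemma quarter_turn_scaleR: "quarter_turn (c *\<^sub>R x) = c *\<^sub>R quarter_turn x"
  by (simp add: pt_eq_iff)

lemma quarter_turn_twice: "quarter_turn (quarter_turn x) = - x"
  by (simp add: pt_eq_iff)

lemma norm_quarter_turn [simp]: "norm (quarter_turn n) = norm n"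
  by (simp add: norm_eq_sqrt_inner)

lemma quarter_turn_eq_0_iff [simp]: "quarter_turn n = 0 \<longleftrightarrow> n = 0"
  using norm_quarter_turn[of n] by (metis norm_eq_zero)

lemma orthogonal_imp_multiple_of_quarter_turn:
  assumes "n \<bullet> d = 0" "n \<noteq> 0"
  obtains c where "d = c *\<^sub>R quarter_turn n"
proof
  have nn: "n $ 1 * n $ 1 + n $ 2 * n $ 2 \<noteq> 0"
    using assms(2) by (metis inner_pt inner_eq_zero_iff)
  have o: "n $ 1 * d $ 1 + n $ 2 * d $ 2 = 0"
    using assms(1) by (simp add: inner_pt)
  have "d $ 1 * (n $ 1 * n $ 1 + n $ 2 * n $ 2) = (d $ 2 * n $ 1 - d $ 1 * n $ 2) * - (n $ 2)"
    using o by algebra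
  moreover have "d $ 2 * (n $ 1 * n $ 1 + n $ 2 * n $ 2) = (d $ 2 * n $ 1 - d $ 1 * n $ 2) * n $ 1"
    using o by algebra
  ultimately have "d $ 1 = (d $ 2 * n $ 1 - d $ 1 * n $ 2) * - (n $ 2) / (n $ 1 * n $ 1 + n $ 2 * n $ 2)"
    "d $ 2 = (d $ 2 * n $ 1 - d $ 1 * n $ 2) * n $ 1 / (n $ 1 * n $ 1 + n $ 2 * n $ 2)"
    unfolding nonzero_eq_divide_eq[OF nn] .
  then show "d = ((d $ 2 * n $ 1 - d $ 1 * n $ 2) / (n $ 1 * n $ 1 + n $ 2 * n $ 2)) *\<^sub>R quarter_turn n"
    by (simp add: pt_eq_iff)
qed

text \<open>
  Used to exclude degenerate cells: a cell on both sides of one of its edges, or a cell whose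
  closure is a single point.
\<close>

lemma open_set_not_in_line:
  fixes K :: "'a::real_inner set"
  assumes "open K" "K \<noteq> {}" "n \<noteq> 0"
  shows "\<exists>x\<in>K. n \<bullet> (x - p) \<noteq> 0"
proof -
  obtain x where x: "x \<in> K" using assms by blast
  then obtain r where r: "r > 0" "ball x r \<subseteq> K"
    using assms(1) open_contains_ball by blast
  let ?y = "x + (r / 2 / norm n) *\<^sub>R n"
  have "?y \<in> K"
    using r assms(3) by (auto simp: subset_iff mem_ball dist_norm)
  moreover have "n \<bullet> (?y - p) = n \<bullet> (x - p) + r / 2 / norm n * (n \<bullet> n)"
    by (simp add: algebra_simps inner_add_right inner_diff_right)
  moreover have "r / 2 / norm n * (n \<bullet> n) \<noteq> 0"
    using r assms(3) by simp
  ultimately show ?thesis using x by (metis add.left_neutral)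
qed

text \<open>
  In the plane the edges of a cell are its facets.  This makes the general theory of polyhedra
  applicable: facets have supporting hyperplanes, and proper faces are intersections of facets.
\<close>

lemma edge_facet:
  assumes "open_convex_polygon K"
  shows "e \<in> edges K \<longleftrightarrow> e facet_of closure K"
proof -
  have "interior (closure K) \<noteq> {}"
    using assms by (metis open_convex_polygon_def closure_subset interior_maximal subset_empty)
  then have "aff_dim (closure K) = DIM(pt)" by (rule aff_dim_nonempty_interior)
  then have "aff_dim (closure K) = 2" by simp
  then show ?thesis
    by (auto simp: edges_def edge_of_def facet_of_def)
qed

lemma finite_edges: "open_convex_polygon K \<Longrightarrow> finite (edges K)"
  unfolding edges_def edge_of_def open_convex_polygon_def
  by (rule finite_subset [OF _ finite_polytope_faces[of "closure K"]]) auto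

text \<open>
  Two unit vectors orthogonal to the same edge agree up to sign, and both signs are possible
  only if the cell is contained in the line through the edge.
\<close>

lemma outward_normal_eqI:
  assumes K: "open_convex_polygon K" and ab: "a \<noteq> b"
    and n: "norm n = 1" "n \<bullet> (b - a) = 0" "\<And>x. x \<in> K \<Longrightarrow> n \<bullet> (x - a) \<le> 0"
  shows "outward_normal K (closed_segment a b) = n"
  unfolding outward_normal_def
proof (rule the_equality)
  have seg: "\<exists>t. p - a = t *\<^sub>R (b - a)" if "p \<in> closed_segment a b" for p
    using that by (auto simp: closed_segment_def algebra_simps)
  have on: "n \<bullet> (p - a) = 0" if "p \<in> closed_segment a b" for p
    using seg[OF that] n(2) by (metis inner_scaleR_right mult_zero_right)
  have "n \<bullet> (p - q) = 0" if "p \<in> closed_segment a b" "q \<in> closed_segment a b" for p q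
    using on[OF that(1)] on[OF that(2)] by (simp add: inner_diff_right)
  moreover have "n \<bullet> (x - p) \<le> 0" if "p \<in> closed_segment a b" "x \<in> K" for p x
    using on[OF that(1)] n(3)[OF that(2)] by (simp add: inner_diff_right)
  ultimately show "norm n = 1 \<and> (\<forall>p\<in>closed_segment a b. \<forall>q\<in>closed_segment a b. n \<bullet> (p - q) = 0) \<and>
      (\<forall>p\<in>closed_segment a b. \<forall>x\<in>K. n \<bullet> (x - p) \<le> 0)"
    using n(1) by blast
next
  fix m
  assume m: "norm m = 1 \<and> (\<forall>p\<in>closed_segment a b. \<forall>q\<in>closed_segment a b. m \<bullet> (p - q) = 0) \<and>
      (\<forall>p\<in>closed_segment a b. \<forall>x\<in>K. m \<bullet> (x - p) \<le> 0)"
  have mab: "m \<bullet> (b - a) = 0" and mx: "\<And>x. x \<in> K \<Longrightarrow> m \<bullet> (x - a) \<le> 0"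
    using m by auto
  have "b - a \<noteq> 0" using ab by simp
  then obtain c where c: "n = c *\<^sub>R quarter_turn (b - a)"
    using orthogonal_imp_multiple_of_quarter_turn n(2) by (metis inner_commute)
  obtain d where d: "m = d *\<^sub>R quarter_turn (b - a)"
    using \<open>b - a \<noteq> 0\<close> orthogonal_imp_multiple_of_quarter_turn mab by (metis inner_commute)
  have "\<bar>c\<bar> * norm (b - a) = 1" "\<bar>d\<bar> * norm (b - a) = 1"
    using n(1) m c d by (metis norm_scaleR norm_quarter_turn)+
  then have "\<bar>c\<bar> = \<bar>d\<bar>" using \<open>b - a \<noteq> 0\<close> by (metis mult_right_cancel norm_eq_zero)
  then consider "m = n" | "m = - n" using c d by (auto simp: abs_eq_iff)
  then show "m = n"
  proof cases
    case 2
    then have "\<forall>x\<in>K. n \<bullet> (x - a) = 0"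
      using n(3) mx by (metis antisym inner_minus_left neg_le_0_iff_le)
    moreover have "n \<noteq> 0" using n(1) by auto
    ultimately show ?thesis
      using open_set_not_in_line[of K n a] K by (auto simp: open_convex_polygon_def)
  qed
qed

lemma edge_length_segment: "edge_length (closed_segment a b) = norm (b - a)"
proof (rule antisym)
  show "edge_length (closed_segment a b) \<le> norm (b - a)"
    unfolding edge_length_def
  proof (rule diameter_le)
    fix x y assume "x \<in> closed_segment a b" "y \<in> closed_segment a b"
    then obtain s t where "x = (1 - s) *\<^sub>R a + s *\<^sub>R b" "y = (1 - t) *\<^sub>R a + t *\<^sub>R b"
      and st: "0 \<le> s" "s \<le> 1" "0 \<le> t" "t \<le> 1"
      by (auto simp: in_segment)
    then have "x - y = (s - t) *\<^sub>R (b - a)"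
      by (simp only: scaleR_left_diff_distrib scaleR_right_diff_distrib scaleR_one) simp
    then have "norm (x - y) = \<bar>s - t\<bar> * norm (b - a)" by simp
    also have "\<dots> \<le> 1 * norm (b - a)" using st by (intro mult_right_mono) auto
    finally show "norm (x - y) \<le> norm (b - a)" by simp
  qed simp
  show "norm (b - a) \<le> edge_length (closed_segment a b)"
    unfolding edge_length_def
    using diameter_bounded_bound[of "closed_segment a b" b a]
    by (simp add: dist_norm bounded_closed_segment)
qed

text \<open>
  The orientation of an edge that has the cell on its left: \<open>quarter_turn (b - a)\<close> is an inner
  normal.
\<close>

lemma edge_orientation:
  assumes K: "open_convex_polygon K" and e: "e \<in> edges K"
  obtains a b where "e = closed_segment a b" "a \<noteq> b" "norm (outward_normal K e) = 1"
    "b - a = edge_length e *\<^sub>R quarter_turn (outward_normal K e)"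
    "\<And>x. x \<in> closure K \<Longrightarrow> quarter_turn (b - a) \<bullet> (x - a) \<ge> 0"
proof -
  have poly: "polytope (closure K)" using K by (simp add: open_convex_polygon_def)
  have ef: "e face_of closure K" "aff_dim e = 1"
    using e by (auto simp: edges_def edge_of_def)
  obtain w \<beta> where w: "w \<noteq> 0" "closure K \<subseteq> {x. w \<bullet> x \<le> \<beta>}" "e = closure K \<inter> {x. w \<bullet> x = \<beta>}"
    using facet_of_polyhedron[OF polytope_imp_polyhedron[OF poly]] e edge_facet[OF K] by metis
  have pe: "polytope e" using face_of_polytope_polytope[OF poly ef(1)] .
  have "e \<noteq> {}" "collinear e" using ef(2) by (auto simp: collinear_aff_dim)
  then obtain a0 b0 where s0: "e = closed_segment a0 b0"
    using compact_convex_collinear_segment polytope_imp_compact polytope_imp_convex pe by metis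
  have ne: "a0 \<noteq> b0" using ef(2) s0 by auto
  define n where "n = (1 / norm w) *\<^sub>R w"
  have n1: "norm n = 1" using w(1) by (simp add: n_def)
  have on: "w \<bullet> a0 = \<beta>" "w \<bullet> b0 = \<beta>"
    using s0 w(3) ends_in_segment[of a0 b0] by blast+
  have nab: "n \<bullet> (b0 - a0) = 0" using on by (simp add: n_def inner_diff_right)
  have nx: "n \<bullet> (x - a0) \<le> 0" if "x \<in> closure K" for x
    using that w(2) on by (auto simp: n_def inner_diff_right divide_right_mono)
  have N: "outward_normal K e = n"
    unfolding s0 using outward_normal_eqI[OF K ne n1 nab] nx closure_subset by blast
  obtain c where c: "b0 - a0 = c *\<^sub>R quarter_turn n"
    using orthogonal_imp_multiple_of_quarter_turn[OF nab] n1
    by (metis norm_zero zero_neq_one)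
  have L: "edge_length e = \<bar>c\<bar>"
    using c n1 by (simp add: s0 edge_length_segment)
  \<comment> \<open>The sign of \<open>c\<close> tells whether the end points have to be exchanged.\<close>
  have "\<exists>a b. e = closed_segment a b \<and> a \<noteq> b \<and> n \<bullet> a = n \<bullet> a0 \<and> b - a = \<bar>c\<bar> *\<^sub>R quarter_turn n"
  proof (cases "c \<ge> 0")
    case True then show ?thesis using s0 ne c by (intro exI[of _ a0] exI[of _ b0]) auto
  next
    case False
    have "a0 - b0 = - (b0 - a0)" by simp
    also have "\<dots> = \<bar>c\<bar> *\<^sub>R quarter_turn n" using False c by simp
    finally show ?thesis using s0 ne nab
      by (intro exI[of _ b0] exI[of _ a0]) (auto simp: closed_segment_commute inner_diff_right)
  qed
  then obtain a b where ab: "e = closed_segment a b" "a \<noteq> b" "n \<bullet> a = n \<bullet> a0"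
    "b - a = \<bar>c\<bar> *\<^sub>R quarter_turn n" by blast
  have "quarter_turn (b - a) \<bullet> (x - a) \<ge> 0" if "x \<in> closure K" for x
  proof -
    have "quarter_turn (b - a) \<bullet> (x - a) = - (\<bar>c\<bar> * (n \<bullet> (x - a0)))"
      using ab(3)
      by (simp add: ab(4) quarter_turn_scaleR quarter_turn_twice inner_diff_right right_diff_distrib)
    then show ?thesis using nx[OF that] by (simp add: mult_nonneg_nonpos)
  qed
  then show thesis using that ab N n1 L by metis
qed

text \<open>
  Seen from \<open>v\<close>, the cell lies to the left (\<open>s > 0\<close>) or to the right (\<open>s < 0\<close>) of both edges,
  so each edge lies on the same given side of the other one.  This forces them to be
  parallel.  Opposite directions would squeeze the cell into a line; edges in the same direction
  overlap in relative interior points, and then they coincide because they are faces.  The sign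
  \<open>s = 1\<close> gives uniqueness of the edge leaving \<open>v\<close>, and \<open>s = -1\<close> of the edge arriving at \<open>v\<close>.
\<close>

lemma edges_at_vertex_same_side:
  assumes K: "open_convex_polygon K"
    and e1: "closed_segment v p \<in> edges K" and e2: "closed_segment v q \<in> edges K"
    and ne: "v \<noteq> p" "v \<noteq> q" and s: "s \<noteq> (0::real)"
    and side1: "\<And>x. x \<in> closure K \<Longrightarrow> s * (quarter_turn (p - v) \<bullet> (x - v)) \<ge> 0"
    and side2: "\<And>x. x \<in> closure K \<Longrightarrow> s * (quarter_turn (q - v) \<bullet> (x - v)) \<ge> 0"
  shows "closed_segment v p = closed_segment v q"
proof -
  let ?p = "p - v" and ?q = "q - v"
  have f1: "closed_segment v p face_of closure K" and f2: "closed_segment v q face_of closure K"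
    using e1 e2 by (auto simp: edges_def edge_of_def)
  have "p \<in> closure K" "q \<in> closure K"
    using face_of_imp_subset[OF f1] face_of_imp_subset[OF f2] by auto
  then have "s * (quarter_turn ?p \<bullet> ?q) \<ge> 0" "s * (quarter_turn ?q \<bullet> ?p) \<ge> 0"
    using side1 side2 by auto
  moreover have "quarter_turn ?q \<bullet> ?p = - (quarter_turn ?p \<bullet> ?q)"
    by (simp add: inner_pt algebra_simps)
  ultimately have "quarter_turn ?p \<bullet> ?q = 0" using s by auto
  then obtain c' where c': "?q = c' *\<^sub>R quarter_turn (quarter_turn ?p)"
    using orthogonal_imp_multiple_of_quarter_turn ne(1)
    by (metis quarter_turn_eq_0_iff right_minus_eq)
  define c where "c = - c'"
  have c: "?q = c *\<^sub>R ?p" using c' by (simp add: c_def quarter_turn_twice flip: scaleR_minus_right)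
  have "c \<noteq> 0" using c ne(2) by auto
  have "c > 0"
  proof (rule ccontr)
    assume "\<not> c > 0"
    then have "c < 0" using \<open>c \<noteq> 0\<close> by simp
    have "quarter_turn ?p \<bullet> (x - v) = 0" if "x \<in> K" for x
    proof -
      have "c * (s * (quarter_turn ?p \<bullet> (x - v))) \<ge> 0"
        using side2[of x] that closure_subset[of K]
        by (auto simp: c quarter_turn_scaleR mult.left_commute)
      moreover have "s * (quarter_turn ?p \<bullet> (x - v)) \<ge> 0"
        using side1[of x] that closure_subset by auto
      ultimately have "s * (quarter_turn ?p \<bullet> (x - v)) = 0"
        using \<open>c < 0\<close> by (smt (verit) mult_neg_pos)
      then show ?thesis using s by simp
    qed
    moreover have "quarter_turn ?p \<noteq> 0" using ne(1) by simp
    ultimately show False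
      using open_set_not_in_line[of K "quarter_turn ?p" v] K by (auto simp: open_convex_polygon_def)
  qed
  \<comment> \<open>A fraction of the vector \<open>p - v\<close> that ends before \<open>p\<close> and before \<open>q\<close>.\<close>
  define r where "r = min 1 c / 2"
  have r: "0 < r" "r < 1" "r < c" using \<open>c > 0\<close> by (auto simp: r_def min_def)
  let ?z = "v + r *\<^sub>R ?p"
  have "?z \<in> open_segment v p"
    using r ne(1) by (auto simp: in_segment algebra_simps intro!: exI[of _ r])
  moreover have "?z \<in> open_segment v q"
  proof -
    have "?z = v + (r / c) *\<^sub>R ?q" using c \<open>c > 0\<close> by simp
    also have "\<dots> = (1 - r / c) *\<^sub>R v + (r / c) *\<^sub>R q" by (simp add: algebra_simps)
    finally show ?thesis
      unfolding in_segment using r ne(2) \<open>c > 0\<close> by (intro conjI exI[of _ "r / c"]) auto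
  qed
  ultimately have "rel_interior (closed_segment v p) \<inter> rel_interior (closed_segment v q) \<noteq> {}"
    using ne by (auto simp: rel_interior_closed_segment)
  then show ?thesis by (rule face_of_eq[OF f1 f2])
qed

text \<open>
  A vertex is a proper face, hence the intersection of the edges that contain it; with fewer than
  two edges this intersection would be the whole plane or an entire edge.
\<close>

lemma vertex_on_two_edges:
  assumes K: "open_convex_polygon K" and v: "v \<in> vertices K"
  obtains e e' where "e \<in> edges K" "e' \<in> edges K" "e \<noteq> e'" "v \<in> e" "v \<in> e'"
proof -
  let ?F = "{F. F facet_of closure K \<and> {v} \<subseteq> F}"
  have poly: "polyhedron (closure K)"
    using K polytope_imp_polyhedron by (auto simp: open_convex_polygon_def)
  have "{v} face_of closure K" using v by (simp add: vertices_def face_of_singleton)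
  moreover have "{v} \<noteq> closure K"
  proof
    assume "{v} = closure K"
    then have "K \<subseteq> {v}" using closure_subset by metis
    then show False
      using K open_set_not_in_line[of K "axis 1 1" v] by (auto simp: open_convex_polygon_def)
  qed
  ultimately have I: "{v} = \<Inter>?F" by (intro face_of_polyhedron[OF poly]) auto
  have "?F \<noteq> {}"
  proof
    assume "?F = {}"
    then have "{v} = UNIV" using I by (metis Inter_empty)
    then have "axis 1 1 + v = v" by blast
    then show False by (simp add: axis_eq_0_iff)
  qed
  then obtain e where e: "e \<in> ?F" by blast
  have "?F \<noteq> {e}"
  proof
    assume "?F = {e}"
    then have "e = {v}" using I by simp
    moreover have "aff_dim e = 1"
      using e edge_facet[OF K, of e] by (simp add: edges_def edge_of_def)
    ultimately show False by simp
  qed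
  then obtain e' where "e' \<in> ?F" "e' \<noteq> e" using e by blast
  then show thesis using that e edge_facet[OF K] by auto
qed

text \<open>
  Of two distinct edges at a vertex, at most one has it as tail and at most one as head; so one
  of them starts there and the other one ends there.  Therefore both end point maps are
  bijections from the edges to the vertices, and the sum of head minus tail telescopes.
\<close>

lemma sum_edge_length_outward_normal:
  assumes K: "open_convex_polygon K"
  shows "(\<Sum>e\<in>edges K. edge_length e *\<^sub>R outward_normal K e) = 0"
proof -
  have "\<forall>e\<in>edges K. \<exists>a b. e = closed_segment a b \<and> a \<noteq> b \<and>
      b - a = edge_length e *\<^sub>R quarter_turn (outward_normal K e) \<and>
      (\<forall>x\<in>closure K. quarter_turn (b - a) \<bullet> (x - a) \<ge> 0)"
    using edge_orientation[OF K] by metis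
  then obtain tail head where E: "\<And>e. e \<in> edges K \<Longrightarrow> e = closed_segment (tail e) (head e)"
      "\<And>e. e \<in> edges K \<Longrightarrow> tail e \<noteq> head e"
      "\<And>e. e \<in> edges K \<Longrightarrow>
        head e - tail e = edge_length e *\<^sub>R quarter_turn (outward_normal K e)"
      "\<And>e x. e \<in> edges K \<Longrightarrow> x \<in> closure K \<Longrightarrow>
        quarter_turn (head e - tail e) \<bullet> (x - tail e) \<ge> 0"
    by metis
  have injt: "inj_on tail (edges K)"
  proof (rule inj_onI)
    fix e e' assume e: "e \<in> edges K" "e' \<in> edges K" "tail e = tail e'"
    have "closed_segment (tail e) (head e) = closed_segment (tail e) (head e')"
    proof (rule edges_at_vertex_same_side[OF K, where s = 1])
      show "closed_segment (tail e) (head e) \<in> edges K" "tail e \<noteq> head e" using E e by metis+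
      show "closed_segment (tail e) (head e') \<in> edges K" "tail e \<noteq> head e'" using E e by metis+
    qed (use E(4)[OF e(1)] E(4)[OF e(2)] e(3) in auto)
    then show "e = e'" using E(1) e by metis
  qed
  have injh: "inj_on head (edges K)"
  proof (rule inj_onI)
    fix e e' assume e: "e \<in> edges K" "e' \<in> edges K" "head e = head e'"
    \<comment> \<open>Traversed backwards, an edge has the cell on its right.\<close>
    have flip: "- 1 * (quarter_turn (tail d - head d) \<bullet> (x - head d)) \<ge> 0"
      if "d \<in> edges K" "x \<in> closure K" for d x
      using E(4)[OF that] by (simp add: inner_pt algebra_simps)
    have "closed_segment (head e) (tail e) = closed_segment (head e) (tail e')"
    proof (rule edges_at_vertex_same_side[OF K, where s = "- 1"])
      show "closed_segment (head e) (tail e) \<in> edges K" "head e \<noteq> tail e"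
        using E e by (metis closed_segment_commute)+
      show "closed_segment (head e) (tail e') \<in> edges K" "head e \<noteq> tail e'"
        using E e by (metis closed_segment_commute)+
    qed (use flip[OF e(1)] flip[OF e(2)] e(3) in auto)
    then show "e = e'" using E(1) e by (metis closed_segment_commute)
  qed
  have extreme: "v \<in> vertices K \<and> v \<in> e \<longleftrightarrow> v = tail e \<or> v = head e" if "e \<in> edges K" for v e
  proof -
    have "e face_of closure K" using that by (simp add: edges_def edge_of_def)
    then show ?thesis
      using extreme_point_of_face[of e "closure K" v] E(1)[OF that]
        extreme_point_of_segment[of v "tail e" "head e"]
      by (simp add: vertices_def)
  qed
  have surj: "v \<in> tail ` edges K \<and> v \<in> head ` edges K" if "v \<in> vertices K" for v
  proof -
    obtain e e' where e: "e \<in> edges K" "e' \<in> edges K" "e \<noteq> e'" "v \<in> e" "v \<in> e'"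
      using vertex_on_two_edges[OF K \<open>v \<in> vertices K\<close>] by metis
    then have "v = tail e \<or> v = head e" "v = tail e' \<or> v = head e'"
      using extreme that by blast+
    moreover have "tail e \<noteq> tail e'" "head e \<noteq> head e'"
      using e injt injh by (auto dest: inj_onD)
    ultimately show ?thesis using e(1,2) by blast
  qed
  have "bij_betw tail (edges K) (vertices K)" "bij_betw head (edges K) (vertices K)"
    unfolding bij_betw_def using injt injh surj extreme by blast+
  then have "(\<Sum>e\<in>edges K. tail e) = (\<Sum>e\<in>edges K. head e)"
    using sum.reindex_bij_betw[of tail "edges K" "vertices K" "\<lambda>v. v"]
      sum.reindex_bij_betw[of head "edges K" "vertices K" "\<lambda>v. v"] by simp
  then have "0 = (\<Sum>e\<in>edges K. head e - tail e)"
    by (simp add: sum_subtractf)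
  also have "\<dots> = quarter_turn (\<Sum>e\<in>edges K. edge_length e *\<^sub>R outward_normal K e)"
    by (simp add: E(3) linear_sum[OF linear_quarter_turn] quarter_turn_scaleR)
  finally show ?thesis by (metis quarter_turn_eq_0_iff)
qed


section \<open>A forward Euler step keeps the cell averages in the invariant domain\<close>

text \<open>
  Without interior part, \<open>G\<close>-admissibility does not mention the cell average, and the average
  has to be recovered from the edge values.  Exactness on the whole reconstruction space does this
  for the unlimited reconstruction; the limiter then combines it with the constant \<open>avg u K\<close>,
  which the weights reproduce since they sum to one.
\<close>

lemma edge_sample_eq_avg:
  fixes S :: "('m::finite, 'j) scheme"
  assumes S: "hybrid_setting S" "cad_edge_only_exact S" and K: "K \<in> cells S"
    and one: "cad_edge_sum S K = 1"
  shows "edge_sample S K (uhat S u K) = avg u K"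
proof -
  let ?r = "rec_op S K u"
  have cad: "\<forall>s\<in>{1..cad_num S K}. cad_int S K s > 0" "(\<Sum>s=1..cad_num S K. cad_int S K s) = 0"
    using S(1) K one by (auto simp: hybrid_setting_def cad_ok_def)
  have "cad_num S K = 0"
  proof (rule ccontr)
    assume "cad_num S K \<noteq> 0"
    then have "(\<Sum>s=1..cad_num S K. cad_int S K s) > 0"
      using cad(1) by (intro sum_pos) auto
    then show False using cad(2) by simp
  qed
  moreover have W: "?r \<in> W S K" "cell_mean K ?r = avg u K"
    using S(1) K by (auto simp: hybrid_setting_def reconstruction_ok_def)
  ultimately have "avg u K = (\<Sum>e\<in>edges K. cad_edge S K e *\<^sub>R edge_mean e ?r)"
    using S(2) K one by (auto simp: cad_edge_only_exact_def cad_exact_on_def)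
  also have "\<dots> = edge_sample S K ?r"
    unfolding edge_sample_def
    using S(1) K W(1) by (intro sum.cong) (auto simp: hybrid_setting_def quadrature_ok_def)
  finally have rec: "edge_sample S K ?r = avg u K" by simp
  have q1: "(\<Sum>\<nu>=1..Nq S. qweight S e \<nu>) = 1" if "e \<in> edges K" for e
    using S(1) K that by (auto simp: hybrid_setting_def quadrature_ok_def all_edges_def)
  define t where "t = theta S K (avg u K) ?r"
  have "edge_sample S K (uhat S u K) = (\<Sum>e\<in>edges K. cad_edge S K e *\<^sub>R
      ((1 - t) *\<^sub>R avg u K + t *\<^sub>R (\<Sum>\<nu>=1..Nq S. qweight S e \<nu> *\<^sub>R ?r (qnode S e \<nu>))))"
    unfolding edge_sample_def
  proof (intro sum.cong refl arg_cong[where f = "\<lambda>x. _ *\<^sub>R x"])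
    fix e assume e: "e \<in> edges K"
    have "(\<Sum>\<nu>=1..Nq S. qweight S e \<nu> *\<^sub>R uhat S u K (qnode S e \<nu>)) =
       (\<Sum>\<nu>=1..Nq S. qweight S e \<nu> *\<^sub>R ((1 - t) *\<^sub>R avg u K)
          + t *\<^sub>R (qweight S e \<nu> *\<^sub>R ?r (qnode S e \<nu>)))"
      by (intro sum.cong) (auto simp: uhat_def limiter_def t_def algebra_simps)
    also have "\<dots> = (1 - t) *\<^sub>R avg u K +
        t *\<^sub>R (\<Sum>\<nu>=1..Nq S. qweight S e \<nu> *\<^sub>R ?r (qnode S e \<nu>))"
      unfolding sum.distrib scaleR_sum_left[symmetric] scaleR_sum_right[symmetric] q1[OF e] by simp
    finally show "(\<Sum>\<nu>=1..Nq S. qweight S e \<nu> *\<^sub>R uhat S u K (qnode S e \<nu>)) = \<dots>" .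
  qed
  also have "\<dots> = cad_edge_sum S K *\<^sub>R ((1 - t) *\<^sub>R avg u K) + t *\<^sub>R edge_sample S K ?r"
    unfolding edge_sample_def cad_edge_sum_def
    by (simp add: sum.distrib scaleR_sum_right scaleR_sum_left scaleR_add_right mult_ac
        flip: scaleR_sum_left sum_distrib_left)
  also have "\<dots> = avg u K" using one rec by (simp add: algebra_simps)
  finally show ?thesis .
qed

text \<open>
  The average is the edge sample plus \<open>1 - \<Lambda>\<close> times a state of \<open>G\<close>, where \<open>\<Lambda>\<close> is the total edge
  weight, and dropping that state can only decrease an affine function that is nonnegative on \<open>G\<close>.
\<close>

lemma edge_sample_le_avg:
  fixes S :: "('m::finite, 'j) scheme"
  assumes S: "hybrid_setting S" "cad_edge_only_exact S" and K: "K \<in> cells S"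
    and adm: "G_admissible S K (avg u K) (uhat S u K)"
    and half: "\<And>z. z \<in> G_set S \<Longrightarrow> (z - p) \<bullet> \<xi> \<ge> 0"
  shows "(\<Sum>e\<in>edges K. \<Sum>\<nu>=1..Nq S.
      qweight S e \<nu> * (cad_edge S K e * ((uhat S u K (qnode S e \<nu>) - p) \<bullet> \<xi>)))
      \<le> (avg u K - p) \<bullet> \<xi>"
proof -
  let ?\<Lambda> = "cad_edge_sum S K" and ?E = "edge_sample S K (uhat S u K)"
  have q1: "(\<Sum>\<nu>=1..Nq S. qweight S e \<nu>) = 1" if "e \<in> edges K" for e
    using S(1) K that by (auto simp: hybrid_setting_def quadrature_ok_def all_edges_def)
  have "(\<Sum>\<nu>=1..Nq S. qweight S e \<nu> * (cad_edge S K e * ((uhat S u K (qnode S e \<nu>) - p) \<bullet> \<xi>))) =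
      (cad_edge S K e *\<^sub>R (\<Sum>\<nu>=1..Nq S. qweight S e \<nu> *\<^sub>R uhat S u K (qnode S e \<nu>))) \<bullet> \<xi>
        - cad_edge S K e * (p \<bullet> \<xi>)" if e: "e \<in> edges K" for e
  proof -
    have "(\<Sum>\<nu>=1..Nq S. qweight S e \<nu> * (cad_edge S K e * ((uhat S u K (qnode S e \<nu>) - p) \<bullet> \<xi>))) =
      cad_edge S K e * (\<Sum>\<nu>=1..Nq S. qweight S e \<nu> * (uhat S u K (qnode S e \<nu>) \<bullet> \<xi>))
      - cad_edge S K e * (p \<bullet> \<xi>) * (\<Sum>\<nu>=1..Nq S. qweight S e \<nu>)"
      unfolding sum_distrib_left sum_subtractf[symmetric]
      by (intro sum.cong) (auto simp: inner_diff_left algebra_simps)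
    then show ?thesis using q1[OF e] by (simp add: inner_sum_left)
  qed
  then have sum: "(\<Sum>e\<in>edges K. \<Sum>\<nu>=1..Nq S.
      qweight S e \<nu> * (cad_edge S K e * ((uhat S u K (qnode S e \<nu>) - p) \<bullet> \<xi>))) =
      ?E \<bullet> \<xi> - ?\<Lambda> * (p \<bullet> \<xi>)"
    by (simp add: edge_sample_def cad_edge_sum_def inner_sum_left sum_subtractf sum_distrib_right)
  have "(\<Sum>s=1..cad_num S K. cad_int S K s) \<ge> 0"
    using S(1) K by (intro sum_nonneg) (auto simp: hybrid_setting_def cad_ok_def less_imp_le)
  moreover have "?\<Lambda> + (\<Sum>s=1..cad_num S K. cad_int S K s) = 1"
    using S(1) K by (auto simp: hybrid_setting_def cad_ok_def)
  ultimately consider "?\<Lambda> = 1" | "?\<Lambda> < 1" by linarith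
  then show ?thesis
  proof cases
    case 1
    then show ?thesis
      using sum edge_sample_eq_avg[OF S K 1] by (simp add: inner_diff_left)
  next
    case 2
    define z where "z = (1 / (1 - ?\<Lambda>)) *\<^sub>R (avg u K - ?E)"
    have "avg u K = ?E + (1 - ?\<Lambda>) *\<^sub>R z" using 2 by (simp add: z_def)
    then have "avg u K \<bullet> \<xi> = ?E \<bullet> \<xi> + (1 - ?\<Lambda>) * (z \<bullet> \<xi>)"
      by (metis inner_add_left inner_scaleR_left)
    then have "(avg u K - p) \<bullet> \<xi> = ?E \<bullet> \<xi> - ?\<Lambda> * (p \<bullet> \<xi>) + (1 - ?\<Lambda>) * ((z - p) \<bullet> \<xi>)"
      by (simp add: inner_diff_left algebra_simps)
    moreover have "(z - p) \<bullet> \<xi> \<ge> 0"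
      using adm 2 by (intro half) (simp add: G_admissible_def z_def)
    ultimately show ?thesis using sum 2 by simp
  qed
qed

text \<open>
  The balance at one quadrature node is the fact \<open>point\<close> below.  The viscosity \<open>\<alpha>\<close> and the
  interior speed \<open>\<alpha>'\<close> enter through their mean, so the budget is
  \<open>\<tau> (\<alpha> + \<alpha>') / 2 \<le> \<mu>\<close>; it is met because \<open>\<tau> \<alpha> \<le> 3/2 \<mu>\<close> and \<open>\<tau> \<alpha>' \<le> 1/2 \<mu>\<close>.
\<close>

lemma forward_Euler_average:
  fixes S :: "('m::finite, 'j) scheme"
  assumes S: "hybrid_setting S" "cad_edge_only_exact S" and K: "K \<in> cells S"
    and adm: "limited_admissible S u" and \<tau>: "0 \<le> \<tau>"
    and cfl: "conservative_CFL S u \<tau>" and visc: "visc_resolved S u \<tau>"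
  shows "avg u K + \<tau> *\<^sub>R L_op S u K \<in> G_set S"
proof -
  have poly: "open_convex_polygon K"
    using S(1) K by (auto simp: hybrid_setting_def conforming_mesh_def)
  note fin = finite_edges[OF poly]
  have G: "G_set S = {u. \<forall>j\<in>con_index S. \<forall>us\<in>S_bd S j. (u - us) \<bullet> grad (con S j) us \<ge> 0}"
    using S(1) unfolding hybrid_setting_def invariant_domain_def by blast
  define n where "n = outward_normal K"
  define ui where "ui e \<nu> = uhat S u K (qnode S e \<nu>)" for e \<nu>
  define ue where "ue = outer_state S u K"
  define al where "al e \<nu> = lf_speed S (ui e \<nu>) (n e)" for e \<nu>
  have n1: "norm (n e) = 1" if "e \<in> edges K" for e
    using edge_orientation[OF poly that] unfolding n_def by metis
  have len: "edge_length e > 0" if "e \<in> edges K" for e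
    using edge_orientation[OF poly that] edge_length_segment
    by (metis zero_less_norm_iff right_minus_eq)
  have q: "qweight S e \<nu> > 0" if "e \<in> edges K" "\<nu> \<in> {1..Nq S}" for e \<nu>
    using S(1) K that by (auto simp: hybrid_setting_def quadrature_ok_def all_edges_def)
  have q1: "(\<Sum>\<nu>=1..Nq S. qweight S e \<nu>) = 1" if "e \<in> edges K" for e
    using S(1) K that by (auto simp: hybrid_setting_def quadrature_ok_def all_edges_def)
  have ui: "ui e \<nu> \<in> G_set S" if "e \<in> edges K" "\<nu> \<in> {1..Nq S}" for e \<nu>
    using adm K that by (auto simp: limited_admissible_def G_admissible_def ui_def)
  have ue: "ue e \<nu> \<in> G_set S" if e: "e \<in> edges K" "\<nu> \<in> {1..Nq S}" for e \<nu>
  proof (cases "\<exists>K'. is_neighbour S K e K'")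
    case True
    define N where "N = (SOME K'. is_neighbour S K e K')"
    have "is_neighbour S K e N" unfolding N_def using True by (rule someI_ex)
    then have "N \<in> cells S" "e \<in> edges N" by (auto simp: is_neighbour_def)
    then have "uhat S u N (qnode S e \<nu>) \<in> G_set S"
      using adm e(2) by (auto simp: limited_admissible_def G_admissible_def)
    then show ?thesis using True by (simp add: ue_def outer_state_def N_def)
  next
    case False
    then show ?thesis
      using S(1) K e by (auto simp: ue_def outer_state_def hybrid_setting_def boundary_states_ok_def)
  qed
  have vis: "lf_speed S (ue e \<nu>) (n e) \<le> visc S u K e \<nu>"
    if "e \<in> edges K" "\<nu> \<in> {1..Nq S}" for e \<nu>
    using S(1) K adm that by (auto simp: hybrid_setting_def visc_ok_def ue_def n_def)
  have alpha: "al e \<nu> \<le> alpha_cell S u K" if "e \<in> edges K" "\<nu> \<in> {1..Nq S}" for e \<nu>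
  proof -
    have "finite {al e \<nu> | e \<nu>. e \<in> edges K \<and> \<nu> \<in> {1..Nq S}}"
      using fin by (intro finite_image_set2) auto
    then have "al e \<nu> \<le> Max {al e \<nu> | e \<nu>. e \<in> edges K \<and> \<nu> \<in> {1..Nq S}}"
      using that by (intro Max_ge) blast+
    then show ?thesis by (simp only: alpha_cell_def al_def ui_def n_def)
  qed
  have muK: "mu S K \<le> cad_edge S K e * area K / edge_length e" if "e \<in> edges K" for e
    unfolding mu_def using fin that by (intro Min_le) auto
  define c where "c e = \<tau> * (edge_length e / area K)" for e
  have area: "area K \<ge> 0" by (simp add: area_def)
  have c0: "c e \<ge> 0" if "e \<in> edges K" for e
    using \<tau> area len[OF that] by (simp add: c_def)
  have lam: "c e * ((visc S u K e \<nu> + al e \<nu>) / 2) \<le> cad_edge S K e"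
    if e: "e \<in> edges K" "\<nu> \<in> {1..Nq S}" for e \<nu>
  proof (cases "area K = 0")
    case True
    \<comment> \<open>Here \<open>c e = 0\<close>, a division by zero.\<close>
    then show ?thesis
      using S(1) K e by (auto simp: c_def hybrid_setting_def cad_ok_def less_imp_le)
  next
    case False
    then have A: "area K > 0" using area by simp
    have "\<tau> * (2 * al e \<nu>) \<le> \<tau> * (2 * alpha_cell S u K)"
      using \<tau> alpha[OF e] by (intro mult_left_mono) auto
    also have "\<dots> \<le> mu S K" using cfl K by (auto simp: conservative_CFL_def)
    finally have "\<tau> * (2 * al e \<nu>) \<le> mu S K" .
    moreover have "\<tau> * visc S u K e \<nu> \<le> 3/2 * mu S K"
      using visc K e unfolding visc_resolved_def by blast
    ultimately have "\<tau> * ((visc S u K e \<nu> + al e \<nu>) / 2) \<le> mu S K"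
      by (simp add: algebra_simps)
    also have "\<dots> \<le> cad_edge S K e * area K / edge_length e" by (rule muK[OF e(1)])
    finally show ?thesis
      using A len[OF e(1)] by (simp add: c_def field_simps)
  qed
  have "(avg u K + \<tau> *\<^sub>R L_op S u K - p) \<bullet> grad (con S j) p \<ge> 0"
    if j: "j \<in> con_index S" and p: "p \<in> S_bd S j" for j p
  proof -
    define \<xi> where "\<xi> = grad (con S j) p"
    define \<zeta> where "\<zeta> = lf_zeta S j p"
    define h where "h z = (z - p) \<bullet> \<xi>" for z
    have hG: "h z \<ge> 0" if "z \<in> G_set S" for z
      using that j p by (subst (asm) G) (auto simp: h_def \<xi>_def)
    have LF: "a * h z - flux_dir S z m \<bullet> \<xi> \<ge> \<zeta> \<bullet> m"
      if "z \<in> G_set S" "norm m = 1" "a \<ge> lf_speed S z m" for z m a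
      using S(1) that j p unfolding hybrid_setting_def weak_LF_splitting_def Let_def h_def \<xi>_def \<zeta>_def
      by blast
    define num where "num e \<nu> = (1/2) *\<^sub>R (flux_dir S (ui e \<nu>) (n e) + flux_dir S (ue e \<nu>) (n e))
        - (visc S u K e \<nu> / 2) *\<^sub>R (ue e \<nu> - ui e \<nu>)" for e \<nu>
    have point: "c e * (\<zeta> \<bullet> n e) \<le> cad_edge S K e * h (ui e \<nu>) - c e * (num e \<nu> \<bullet> \<xi>)"
      if e: "e \<in> edges K" "\<nu> \<in> {1..Nq S}" for e \<nu>
    proof -
      let ?v = "visc S u K e \<nu>" and ?F = "\<lambda>z. flux_dir S z (n e) \<bullet> \<xi>"
      have out: "\<zeta> \<bullet> n e \<le> ?v * h (ue e \<nu>) - ?F (ue e \<nu>)"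
        using LF[OF ue[OF e] n1[OF e(1)] vis[OF e]] .
      have inn: "\<zeta> \<bullet> n e \<le> al e \<nu> * h (ui e \<nu>) - ?F (ui e \<nu>)"
        using LF[OF ui[OF e] n1[OF e(1)]] by (simp add: al_def)
      have "num e \<nu> \<bullet> \<xi> = (?F (ui e \<nu>) + ?F (ue e \<nu>)) / 2 - ?v / 2 * (h (ue e \<nu>) - h (ui e \<nu>))"
        by (simp add: num_def h_def inner_diff_left inner_add_left algebra_simps)
      then have "\<zeta> \<bullet> n e \<le> (?v + al e \<nu>) / 2 * h (ui e \<nu>) - num e \<nu> \<bullet> \<xi>"
        using out inn by (simp add: algebra_simps add_divide_distrib diff_divide_distrib)
      then have "c e * (\<zeta> \<bullet> n e) \<le> c e * ((?v + al e \<nu>) / 2 * h (ui e \<nu>) - num e \<nu> \<bullet> \<xi>)"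
        using c0[OF e(1)] by (rule mult_left_mono)
      also have "\<dots> = c e * ((?v + al e \<nu>) / 2) * h (ui e \<nu>) - c e * (num e \<nu> \<bullet> \<xi>)"
        by (simp add: right_diff_distrib)
      also have "\<dots> \<le> cad_edge S K e * h (ui e \<nu>) - c e * (num e \<nu> \<bullet> \<xi>)"
        using mult_right_mono[OF lam[OF e] hG[OF ui[OF e]]] by simp
      finally show ?thesis .
    qed
    have L: "(\<tau> *\<^sub>R L_op S u K) \<bullet> \<xi> =
        - (\<Sum>e\<in>edges K. \<Sum>\<nu>=1..Nq S. qweight S e \<nu> * (c e * (num e \<nu> \<bullet> \<xi>)))"
    proof -
      have "L_op S u K = - (1 / area K) *\<^sub>R (\<Sum>e\<in>edges K. edge_length e *\<^sub>R
          (\<Sum>\<nu>=1..Nq S. qweight S e \<nu> *\<^sub>R num e \<nu>))"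
        by (simp only: L_op_def Let_def num_def ui_def ue_def n_def)
      then have "(\<tau> *\<^sub>R L_op S u K) \<bullet> \<xi> = - (\<tau> / area K * (\<Sum>e\<in>edges K. edge_length e *
          (\<Sum>\<nu>=1..Nq S. qweight S e \<nu> * (num e \<nu> \<bullet> \<xi>))))"
        by (simp add: inner_sum_left)
      also have "\<dots> = - (\<Sum>e\<in>edges K. c e *
          (\<Sum>\<nu>=1..Nq S. qweight S e \<nu> * (num e \<nu> \<bullet> \<xi>)))"
        unfolding c_def sum_distrib_left[of "\<tau> / area K"] by (simp add: mult.assoc)
      finally show ?thesis
        unfolding sum_distrib_left by (simp only: mult.left_commute)
    qed
    have "(\<Sum>e\<in>edges K. c e * (\<zeta> \<bullet> n e)) =
        (\<tau> / area K) * (\<zeta> \<bullet> (\<Sum>e\<in>edges K. edge_length e *\<^sub>R n e))"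
      by (simp add: c_def inner_sum_right sum_distrib_left mult_ac)
    also have "\<dots> = 0" using sum_edge_length_outward_normal[OF poly] by (simp add: n_def)
    finally have "0 = (\<Sum>e\<in>edges K. \<Sum>\<nu>=1..Nq S. qweight S e \<nu> * (c e * (\<zeta> \<bullet> n e)))"
      using q1 by (simp flip: sum_distrib_right)
    also have "\<dots> \<le> (\<Sum>e\<in>edges K. \<Sum>\<nu>=1..Nq S.
        qweight S e \<nu> * (cad_edge S K e * h (ui e \<nu>) - c e * (num e \<nu> \<bullet> \<xi>)))"
      using q point by (intro sum_mono mult_left_mono) (auto simp: less_imp_le)
    also have "\<dots> = (\<Sum>e\<in>edges K. \<Sum>\<nu>=1..Nq S. qweight S e \<nu> * (cad_edge S K e * h (ui e \<nu>)))
        + (\<tau> *\<^sub>R L_op S u K) \<bullet> \<xi>"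
      unfolding L by (simp add: right_diff_distrib sum_subtractf)
    also have "\<dots> \<le> h (avg u K) + (\<tau> *\<^sub>R L_op S u K) \<bullet> \<xi>"
      using edge_sample_le_avg[OF S K _ , of u p \<xi>] adm K hG
      by (auto simp: limited_admissible_def h_def ui_def)
    finally show ?thesis
      by (simp add: h_def \<xi>_def inner_add_left inner_diff_left algebra_simps)
  qed
  then show ?thesis by (subst G) auto
qed


section \<open>Stages as convex combinations of forward Euler steps\<close>

text \<open>
  Points of weight zero are exempt because the step size conditions of a Runge--Kutta stage
  are imposed only where the coefficient is positive.
\<close>

lemma convex_sum_support:
  fixes f :: "'i \<Rightarrow> 'a::real_vector"
  assumes "convex C" "finite I" "sum a I = 1" "\<And>i. i \<in> I \<Longrightarrow> a i \<ge> 0"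
    and "\<And>i. i \<in> I \<Longrightarrow> a i > 0 \<Longrightarrow> f i \<in> C"
  shows "(\<Sum>i\<in>I. a i *\<^sub>R f i) \<in> C"
proof -
  let ?J = "{i \<in> I. a i > 0}"
  have zero: "a i = 0" if "i \<in> I - ?J" for i
    using that assms(4)[of i] by fastforce
  have "sum a ?J = sum a I"
    using assms(2) zero by (intro sum.mono_neutral_left) auto
  then have "(\<Sum>i\<in>?J. a i *\<^sub>R f i) \<in> C"
    using assms by (intro convex_sum) auto
  also have "(\<Sum>i\<in>?J. a i *\<^sub>R f i) = (\<Sum>i\<in>I. a i *\<^sub>R f i)"
    using assms(2) zero by (intro sum.mono_neutral_left) auto
  finally show ?thesis .
qed

lemma btrans_in_G_pt: "exact_setting S \<or> practical_setting S \<Longrightarrow> btrans S w \<in> G_pt S"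
  by (auto simp: exact_setting_def practical_setting_def)

theorem corollary2p11:
  fixes S :: "('m::finite, 'j) scheme"
  assumes "hybrid_setting S"
    and "exact_setting S \<or> practical_setting S"
    and "cad_edge_only_exact S"
  shows "(\<forall>s a c dt U.
            0 \<le> dt \<and> ssp_stages S s a c dt U \<and> hybrid_admissible S (U 0) \<and>
            (\<forall>j<s. limited_admissible S (U j)) \<and>
            (practical_setting S \<longrightarrow> (\<forall>j<s. transform_defined S (U j))) \<and>
            (\<forall>i\<in>{1..s}. \<forall>j<i. a i j > 0 \<longrightarrow>
               conservative_CFL S (U j) (c i j * dt) \<and> visc_resolved S (U j) (c i j * dt))
            \<longrightarrow> (\<forall>i\<le>s. hybrid_admissible S (U i)))
       \<and> (\<forall>dt u0 u1 u2 u3.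
            0 \<le> dt \<and> ssprk3_step S dt u0 u1 u2 u3 \<and> hybrid_admissible S u0 \<and>
            (\<forall>v\<in>{u0, u1, u2}. limited_admissible S v) \<and>
            (practical_setting S \<longrightarrow> (\<forall>v\<in>{u0, u1, u2}. transform_defined S v)) \<and>
            (\<forall>v\<in>{u0, u1, u2}. conservative_CFL S v dt \<and> visc_resolved S v dt)
            \<longrightarrow> hybrid_admissible S u1 \<and> hybrid_admissible S u2 \<and> hybrid_admissible S u3)"
proof (intro conjI allI impI; elim conjE)
  have conv: "convex (G_set S)"
    using assms(1) unfolding hybrid_setting_def invariant_domain_def by blast
  note euler = forward_Euler_average[OF assms(1,3)]
  note pt = btrans_in_G_pt[OF assms(2)]
  {
    fix s a c dt i and U :: "nat \<Rightarrow> 'm hybrid"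
    assume dt: "0 \<le> dt" and stages: "ssp_stages S s a c dt U" and init: "hybrid_admissible S (U 0)"
      and lim: "\<forall>j<s. limited_admissible S (U j)" and "i \<le> s"
      and cfl: "\<forall>i\<in>{1..s}. \<forall>j<i. a i j > 0 \<longrightarrow>
        conservative_CFL S (U j) (c i j * dt) \<and> visc_resolved S (U j) (c i j * dt)"
    show "hybrid_admissible S (U i)"
    proof (cases "i = 0")
      case True
      then show ?thesis using init by simp
    next
      case False
      then have i: "i \<in> {1..s}" using \<open>i \<le> s\<close> by auto
      note st = stages[unfolded ssp_stages_def, rule_format, OF i]
      have "avg (U i) K \<in> G_set S" if K: "K \<in> cells S" for K
      proof -
        have "(\<Sum>j<i. a i j *\<^sub>R (avg (U j) K + (c i j * dt) *\<^sub>R L_op S (U j) K)) \<in> G_set S"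
        proof (rule convex_sum_support[OF conv])
          fix j assume j: "j \<in> {..<i}" "a i j > 0"
          show "avg (U j) K + (c i j * dt) *\<^sub>R L_op S (U j) K \<in> G_set S"
            using euler[OF K] lim cfl i j dt st by auto
        qed (use st in auto)
        then show ?thesis using st K by simp
      qed
      then show ?thesis using st pt by (simp add: hybrid_admissible_def)
    qed
  }
  fix dt u0 u1 u2 u3
  assume dt: "0 \<le> dt" and step: "ssprk3_step S dt u0 u1 u2 u3" and init: "hybrid_admissible S u0"
    and lim: "\<forall>v\<in>{u0, u1, u2}. limited_admissible S v"
    and cfl: "\<forall>v\<in>{u0, u1, u2}. conservative_CFL S v dt \<and> visc_resolved S v dt"
  have fe: "avg v K + dt *\<^sub>R L_op S v K \<in> G_set S" if "v \<in> {u0, u1, u2}" "K \<in> cells S" for v K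
    using euler[OF that(2) _ dt] lim cfl that(1) by blast
  have avg0: "avg u0 K \<in> G_set S" if "K \<in> cells S" for K
    using init that by (simp add: hybrid_admissible_def)
  note st = step[unfolded ssprk3_step_def Let_def]
  show "hybrid_admissible S u1"
    using st fe pt by (auto simp: hybrid_admissible_def)
  show "hybrid_admissible S u2"
    using st fe[of u1] avg0 pt convexD[OF conv, of _ _ "3/4" "1/4"]
    by (auto simp: hybrid_admissible_def)
  show "hybrid_admissible S u3"
    using st fe[of u2] avg0 pt convexD[OF conv, of _ _ "1/3" "2/3"]
    by (auto simp: hybrid_admissible_def)
qed

end
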